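(* Let $a\in(0,1/2)$ and $\lambda>0$, and let $\eta$ be distributed according to $\pi^{\lambda,a}_N$. If $\lambda\ge\lambda_c(a)$, then for every $\varepsilon>0$, $$\lim_{N\to\infty}\pi^{\lambda,a}_N\Big(\max_{x\in[0,1]}\Big|\tfrac1N\eta(Nx)-f_{a,\lambda}(x)\Big|\ge\varepsilon\Big)=0,$$ where $f_{a,\lambda}(x)=\max\big(a-d_\lambda x,\ 0,\ a+d_\lambda(x-1)\big)$ and $d_\lambda=1-2/\lambda$. If $\lambda<\lambda_c(a)$, then for every $\varepsilon>0$, $$\lim_{N\to\infty}\pi^{\lambda,a}_N\Big(\max_{x\in[0,1]}\Big|\tfrac1N\eta(Nx)-a\Big|\ge\varepsilon\Big)=0.$$ (Limits along even $N$.)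
   Context: For a real $s$, $\langle s\rangle$ is the smallest even integer $\ge s$. For $N$ even and $a\in(0,1/2)$, $\mathcal S^a_N$ is the set of $\eta=(\eta_x)_{x\in\{0,\dots,N\}}$ with values in $\mathbb Z_{\ge0}$, $\eta_0=\eta_N=\langle aN\rangle$, $|\eta_{x+1}-\eta_x|=1$. $H(\eta)=\#\{x:\eta_x=0\}$, and $\pi^{\lambda,a}_N(\eta)=\lambda^{H(\eta)}/Z^{\lambda,a}_N$ with $Z^{\lambda,a}_N=\sum_{\eta\in\mathcal S^a_N}\lambda^{H(\eta)}$. For non-integer $Nx$, $\eta(Nx)$ denotes the linear interpolation of $\eta$. Let $\textsc{f}(\lambda)=\log\big(\frac{\lambda}{2\sqrt{\lambda-1}}\big)$ for $\lambda>2$, $0$ otherwise. $\lambda_c(a)$ is the unique solution $\lambda$ of $\textsc{f}(\lambda)=a\log(\lambda-1)$.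
   Formalization: The equation F(λ) = a log(λ−1) also has the trivial root λ = 2 (both sides vanish), so its solution is not unique as stated; λ_c(a) is taken to be the unique solution with λ > 2. *)

theory Defs
  imports "HOL-Analysis.Analysis"
begin

definition even_ceil :: "real \<Rightarrow> int" where
  "even_ceil s = (LEAST k::int. even k \<and> s \<le> real_of_int k)"

text \<open>Paths eta on {0..N}, encoded as functions nat => nat, set to 0 beyond N
  (so that the set is finite).\<close>
definition paths :: "nat \<Rightarrow> real \<Rightarrow> (nat \<Rightarrow> nat) set" where
  "paths N a = {\<eta>. int (\<eta> 0) = even_ceil (a * real N) \<and> int (\<eta> N) = even_ceil (a * real N)
      \<and> (\<forall>x<N. \<bar>int (\<eta> (x+1)) - int (\<eta> x)\<bar> = 1)
      \<and> (\<forall>x>N. \<eta> x = 0)}"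

definition Hzeros :: "nat \<Rightarrow> (nat \<Rightarrow> nat) \<Rightarrow> nat" where
  "Hzeros N \<eta> = card {x. x \<le> N \<and> \<eta> x = 0}"

definition partfun :: "nat \<Rightarrow> real \<Rightarrow> real \<Rightarrow> real" where
  "partfun N lam a = (\<Sum>\<eta>\<in>paths N a. lam ^ Hzeros N \<eta>)"

definition piN :: "nat \<Rightarrow> real \<Rightarrow> real \<Rightarrow> ((nat \<Rightarrow> nat) \<Rightarrow> bool) \<Rightarrow> real" where
  "piN N lam a P = (\<Sum>\<eta>\<in>{\<eta>\<in>paths N a. P \<eta>}. lam ^ Hzeros N \<eta>) / partfun N lam a"

definition interp :: "(nat \<Rightarrow> nat) \<Rightarrow> real \<Rightarrow> real" where
  "interp \<eta> y = (let k = nat \<lfloor>y\<rfloor> in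
      real (\<eta> k) + (y - real k) * (real (\<eta> (Suc k)) - real (\<eta> k)))"

definition Ffree :: "real \<Rightarrow> real" where
  "Ffree lam = (if lam > 2 then ln (lam / (2 * sqrt (lam - 1))) else 0)"

text \<open>Nontrivial solution (lam > 2); lam = 2 is a trivial solution of the equation.\<close>
definition lambda_c :: "real \<Rightarrow> real" where
  "lambda_c a = (THE lam. lam > 2 \<and> Ffree lam = a * ln (lam - 1))"

definition dlam :: "real \<Rightarrow> real" where
  "dlam lam = 1 - 2 / lam"

definition fprof :: "real \<Rightarrow> real \<Rightarrow> real \<Rightarrow> real" where
  "fprof a lam x = max (a - dlam lam * x) (max 0 (a + dlam lam * (x - 1)))"

end

theory Submission
  imports Defs "HOL-Real_Asymp.Real_Asymp"
begin

text \<open>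
  Let \<open>W\<close> be the transfer weights of the walk. For \<open>\<lambda> > 2\<close>, with \<open>r = (\<lambda> - 1)\<^sup>-\<^sup>1\<^sup>/\<^sup>2\<close> and
  \<open>\<theta> = r + 1 / r = 2 exp F(\<lambda>)\<close>, the transfer operator has an eigenfunction decaying like \<open>r\<^sup>y\<close>
  with eigenvalue \<open>\<theta>\<close>. Hence \<open>W\<^sub>n(y, 0) = W\<^sub>n(0, y) \<le> C \<theta>\<^sup>n r\<^sup>y\<close>, and reversibility together with
  the Cauchy-Schwarz inequality gives \<open>Z \<ge> c M\<close> with \<open>M = \<theta>\<^sup>N r\<^sup>2\<^sup>A\<close>, \<open>A\<close> the boundary height.

  Walks without zeros number at most \<open>binomial N (N/2) = o(2\<^sup>N)\<close>, and \<open>\<lambda> \<ge> \<lambda>\<^sub>c\<close> says precisely that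
  \<open>M\<close> is at least of order \<open>2\<^sup>N\<close>; this settles the critical case, where the exponential rates agree.
  A walk that has a zero and is far from the profile either rises macroscopically between two zeros,
  or leaves the line of slope \<open>- d\<close> before its first zero, up to time reversal. Cutting walks at the
  relevant times and tilting the free walk by \<open>r\<close>, which produces the drift \<open>- d\<close>, bounds the
  weight of these events by \<open>M\<close> times an exponentially small factor.

  For \<open>\<lambda> < \<lambda>\<^sub>c\<close> the weight of walks with a zero is increasing in \<open>\<lambda>\<close>, so it is at most of order
  \<open>N M\<close> for some larger parameter in \<open>(2, \<lambda>\<^sub>c)\<close>, which is exponentially smaller than \<open>2\<^sup>N\<close>. Since
  the identity is harmonic for the walk killed at zero, the Cauchy-Schwarz argument also shows that
  there are at least \<open>2\<^sup>N\<close> divided by a polynomial positive bridges.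
\<close>

section \<open>Walks and transfer operator\<close>

lemma even_ceil_eq: "even_ceil s = 2 * \<lceil>s / 2\<rceil>"
  unfolding even_ceil_def
proof (rule Least_equality)
  show "even (2 * \<lceil>s / 2\<rceil>) \<and> s \<le> real_of_int (2 * \<lceil>s / 2\<rceil>)"
    using le_of_int_ceiling[of "s / 2"] by (simp del: le_of_int_ceiling)
next
  fix k :: int
  assume k: "even k \<and> s \<le> real_of_int k"
  then obtain m where m: "k = 2 * m" by blast
  with k have "s / 2 \<le> real_of_int m" by simp
  then show "2 * \<lceil>s / 2\<rceil> \<le> k" unfolding m by (simp add: ceiling_le_iff)
qed

definition walks :: "nat \<Rightarrow> nat \<Rightarrow> nat \<Rightarrow> (nat \<Rightarrow> nat) set" where
  "walks n y z = {\<eta>. \<eta> 0 = y \<and> \<eta> n = z \<and> (\<forall>x<n. \<bar>int (\<eta> (x+1)) - int (\<eta> x)\<bar> = 1)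
      \<and> (\<forall>x>n. \<eta> x = 0)}"

definition weight :: "real \<Rightarrow> nat \<Rightarrow> nat \<Rightarrow> nat \<Rightarrow> real" where
  "weight lam n y z = (\<Sum>\<eta>\<in>walks n y z. lam ^ Hzeros n \<eta>)"

definition site :: "real \<Rightarrow> nat \<Rightarrow> real" where
  "site lam y = (if y = 0 then lam else 1)"

definition transfer :: "real \<Rightarrow> (nat \<Rightarrow> real) \<Rightarrow> nat \<Rightarrow> real" where
  "transfer lam g y = (if y = 0 then g 1 else site lam (y - 1) * g (y - 1) + g (y + 1))"

definition walk_kernel :: "real \<Rightarrow> nat \<Rightarrow> nat \<Rightarrow> nat \<Rightarrow> real" where
  "walk_kernel lam n y z = (transfer lam ^^ n) (\<lambda>u. of_bool (u = z)) y"

lemma walks_0: "walks 0 y z = (if y = z then {\<lambda>t. if t = 0 then y else 0} else {})"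
  by (auto simp: walks_def fun_eq_iff)

lemma walks_Suc:
  "walks (Suc n) y z =
    case_nat y ` (walks n (Suc y) z \<union> (if y = 0 then {} else walks n (y - 1) z))"
proof (intro equalityI subsetI)
  fix \<eta> assume *: "\<eta> \<in> walks (Suc n) y z"
  have eq: "\<eta> = case_nat y (\<lambda>t. \<eta> (Suc t))"
    using * by (auto simp: walks_def fun_eq_iff split: nat.split)
  have "\<bar>int (\<eta> 1) - int y\<bar> = 1" using * by (auto simp: walks_def)
  then have "\<eta> 1 = Suc y \<or> (y \<noteq> 0 \<and> \<eta> 1 = y - 1)" by auto
  moreover have "(\<lambda>t. \<eta> (Suc t)) \<in> walks n (\<eta> 1) z" using * by (auto simp: walks_def)
  ultimately have "(\<lambda>t. \<eta> (Suc t)) \<in> walks n (Suc y) z \<union> (if y = 0 then {} else walks n (y - 1) z)"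
    by auto
  with eq show "\<eta> \<in> case_nat y ` (walks n (Suc y) z \<union> (if y = 0 then {} else walks n (y - 1) z))"
    by blast
next
  fix \<eta> assume "\<eta> \<in> case_nat y ` (walks n (Suc y) z \<union> (if y = 0 then {} else walks n (y - 1) z))"
  then obtain \<zeta> where \<zeta>: "\<eta> = case_nat y \<zeta>" "\<zeta> \<in> walks n (Suc y) z \<or> (y \<noteq> 0 \<and> \<zeta> \<in> walks n (y - 1) z)"
    by (auto split: if_splits)
  then show "\<eta> \<in> walks (Suc n) y z"
    by (auto simp: walks_def split: nat.split)
qed

lemma finite_walks [simp]: "finite (walks n y z)"
  by (induction n arbitrary: y) (auto simp: walks_0 walks_Suc)

lemma Hzeros_0: "Hzeros 0 \<eta> = of_bool (\<eta> 0 = 0)"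
proof -
  have "{x. x \<le> 0 \<and> \<eta> x = 0} = (if \<eta> 0 = 0 then {0} else {})"
    by (auto intro: gr0I)
  then show ?thesis by (simp add: Hzeros_def)
qed

lemma Hzeros_case_nat: "Hzeros (Suc n) (case_nat y \<eta>) = of_bool (y = 0) + Hzeros n \<eta>"
proof -
  have eq: "{x. x \<le> Suc n \<and> (case_nat y \<eta> x) = 0}
      = (if y = 0 then {0} else {}) \<union> Suc ` {x. x \<le> n \<and> \<eta> x = 0}" (is "_ = ?A \<union> ?B")
  proof (intro set_eqI)
    fix x show "x \<in> {x. x \<le> Suc n \<and> (case_nat y \<eta> x) = 0} \<longleftrightarrow> x \<in> ?A \<union> ?B"
      by (cases x) (auto simp: image_iff)
  qed
  have "card (?A \<union> ?B) = card ?A + card ?B"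
    by (intro card_Un_disjoint) auto
  then show ?thesis by (simp add: Hzeros_def eq card_image)
qed

lemma site_power: "lam ^ of_bool (y = 0) = site lam y"
  by (simp add: site_def)

lemma weight_0: "weight lam 0 y z = site lam y * of_bool (y = z)"
  by (auto simp: weight_def walks_0 Hzeros_0 site_def)

lemma weight_Suc:
  "weight lam (Suc n) y z = site lam y *
    (weight lam n (Suc y) z + (if y = 0 then 0 else weight lam n (y - 1) z))"
proof -
  let ?B = "if y = 0 then {} else walks n (y - 1) z"
  have inj: "inj_on (case_nat y) X" for X :: "(nat \<Rightarrow> nat) set"
  proof (rule inj_onI)
    fix f g :: "nat \<Rightarrow> nat" assume "case_nat y f = case_nat y g"
    then have "case_nat y f (Suc t) = case_nat y g (Suc t)" for t by simp
    then show "f = g" by (simp add: fun_eq_iff)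
  qed
  have "weight lam (Suc n) y z = (\<Sum>\<eta>\<in>walks n (Suc y) z \<union> ?B. lam ^ (of_bool (y = 0) + Hzeros n \<eta>))"
    unfolding weight_def walks_Suc by (subst sum.reindex[OF inj]) (simp add: Hzeros_case_nat o_def)
  also have "\<dots> = site lam y * (\<Sum>\<eta>\<in>walks n (Suc y) z \<union> ?B. lam ^ Hzeros n \<eta>)"
    by (simp add: power_add site_power sum_distrib_left)
  also have "(\<Sum>\<eta>\<in>walks n (Suc y) z \<union> ?B. lam ^ Hzeros n \<eta>)
      = (\<Sum>\<eta>\<in>walks n (Suc y) z. lam ^ Hzeros n \<eta>) + (\<Sum>\<eta>\<in>?B. lam ^ Hzeros n \<eta>)"
    by (rule sum.union_disjoint) (auto, auto simp: walks_def)
  finally show ?thesis by (simp add: weight_def)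
qed

lemma walk_kernel_0: "walk_kernel lam 0 y z = of_bool (y = z)"
  by (simp add: walk_kernel_def)

lemma walk_kernel_Suc:
  "walk_kernel lam (Suc n) y z =
    walk_kernel lam n (Suc y) z + (if y = 0 then 0 else site lam (y - 1) * walk_kernel lam n (y - 1) z)"
  by (simp add: walk_kernel_def transfer_def)

lemma weight_eq_kernel: "weight lam n y z = site lam y * walk_kernel lam n y z"
  by (induction n arbitrary: y) (auto simp: weight_0 walk_kernel_0 weight_Suc walk_kernel_Suc site_def)

lemma transfer_0: "transfer lam g 0 = g 1"
  and transfer_Suc: "transfer lam g (Suc y) = site lam y * g y + g (Suc (Suc y))"
  by (simp_all add: transfer_def)

lemma transfer_delta:
  "transfer lam (\<lambda>u. of_bool (u = z)) =
    (\<lambda>y. site lam z * of_bool (y = Suc z) + site lam z * (if z = 0 then 0 else of_bool (y = z - 1)))"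
  by (auto simp: transfer_def fun_eq_iff site_def)

lemma transfer_pow_linear:
  "(transfer lam ^^ n) (\<lambda>y. b * g y + c * h y) =
    (\<lambda>y. b * (transfer lam ^^ n) g y + c * (transfer lam ^^ n) h y)"
proof (induction n)
  case (Suc n)
  show ?case
  proof
    show "(transfer lam ^^ Suc n) (\<lambda>y. b * g y + c * h y) y =
        b * (transfer lam ^^ Suc n) g y + c * (transfer lam ^^ Suc n) h y" for y
      using Suc by (cases y) (simp_all add: transfer_0 transfer_Suc algebra_simps)
  qed
qed simp

lemma walk_kernel_Suc_end:
  "walk_kernel lam (Suc n) y z =
    site lam z * (walk_kernel lam n y (Suc z) + (if z = 0 then 0 else walk_kernel lam n y (z - 1)))"
proof -
  have "walk_kernel lam (Suc n) y z = (transfer lam ^^ n) (transfer lam (\<lambda>u. of_bool (u = z))) y"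
    by (simp add: walk_kernel_def funpow_swap1)
  also have "\<dots> = site lam z * walk_kernel lam n y (Suc z) +
      site lam z * (transfer lam ^^ n) (\<lambda>y. if z = 0 then 0 else of_bool (y = z - 1)) y"
    by (simp add: transfer_delta transfer_pow_linear walk_kernel_def)
  also have "(transfer lam ^^ n) (\<lambda>y. if z = 0 then 0 else of_bool (y = z - 1)) y
      = (if z = 0 then 0 else walk_kernel lam n y (z - 1))"
    using transfer_pow_linear[of n lam 0 "\<lambda>_. 0" 0 "\<lambda>_. 0"] by (auto simp: walk_kernel_def fun_eq_iff)
  finally show ?thesis by (simp add: algebra_simps)
qed

lemma weight_sym: "weight lam n y z = weight lam n z y"
proof (induction n arbitrary: y z)
  case (Suc n)
  show ?case
    unfolding weight_eq_kernel[of lam "Suc n" y z] walk_kernel_Suc_end weight_Suc[of lam n z y]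
    using Suc[of "Suc z" y] Suc[of "z - 1" y] by (simp add: weight_eq_kernel algebra_simps)
qed (auto simp: weight_0)

lemma walk_kernel_eq_0: "y + n < z \<Longrightarrow> walk_kernel lam n y z = 0"
  by (induction n arbitrary: y) (auto simp: walk_kernel_0 walk_kernel_Suc)

lemma transfer_pow_eq_sum:
  assumes "y + n \<le> M"
  shows "(transfer lam ^^ n) g y = (\<Sum>u\<le>M. walk_kernel lam n y u * g u)"
  using assms
proof (induction n arbitrary: y)
  case 0
  then show ?case by (simp add: walk_kernel_0 of_bool_def if_distrib[where f="\<lambda>x. x * _"] cong: if_cong)
next
  case (Suc n)
  then have "(transfer lam ^^ n) g (Suc y) = (\<Sum>u\<le>M. walk_kernel lam n (Suc y) u * g u)"
    and "(transfer lam ^^ n) g (y - 1) = (\<Sum>u\<le>M. walk_kernel lam n (y - 1) u * g u)"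
    by auto
  then show ?case
    by (cases y) (simp_all add: transfer_0 transfer_Suc walk_kernel_Suc sum.distrib[symmetric]
        sum_distrib_left algebra_simps)
qed

lemma site_nonneg: "0 \<le> lam \<Longrightarrow> 0 \<le> site lam y"
  by (simp add: site_def)

lemma walk_kernel_nonneg: "0 \<le> lam \<Longrightarrow> 0 \<le> walk_kernel lam n y z"
  by (induction n arbitrary: y) (auto simp: walk_kernel_0 walk_kernel_Suc site_nonneg)

lemma weight_nonneg: "0 \<le> lam \<Longrightarrow> 0 \<le> weight lam n y z"
  by (simp add: weight_eq_kernel walk_kernel_nonneg site_nonneg)

lemma walk_kernel_supersolution:
  assumes lam: "0 \<le> lam" and g: "\<And>y. 0 \<le> g y"
    and super: "\<And>y. transfer lam g y \<le> \<theta> * g y"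
  shows "walk_kernel lam n y z * g z \<le> \<theta> ^ n * g y"
proof (induction n arbitrary: y)
  case 0
  show ?case using g by (auto simp: walk_kernel_0)
next
  case (Suc n)
  show ?case
  proof (cases "0 \<le> \<theta>")
    case True
    have "walk_kernel lam (Suc n) y z * g z \<le> \<theta> ^ n * transfer lam g y"
      using Suc[of "Suc y"] mult_left_mono[OF Suc[of "y - 1"] site_nonneg[OF lam, of "y - 1"]]
      by (auto simp: walk_kernel_Suc transfer_def algebra_simps)
    also have "\<dots> \<le> \<theta> ^ n * (\<theta> * g y)" using super True by (intro mult_left_mono) auto
    finally show ?thesis by (simp add: algebra_simps)
  next
    case False
    have "0 \<le> transfer lam g u" for u
      using g by (auto simp: transfer_def intro!: add_nonneg_nonneg mult_nonneg_nonneg site_nonneg[OF lam])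
    then have "0 \<le> \<theta> * g u" for u using super order_trans by blast
    then have "g u = 0" for u using False g by (metis linorder_not_le mult_neg_pos order_less_le)
    then show ?thesis by simp
  qed
qed

lemma transfer_pow_eigen:
  assumes "\<And>y. site lam y \<noteq> 0 \<Longrightarrow> transfer lam g y = \<theta> * g y" and "site lam y \<noteq> 0"
  shows "(transfer lam ^^ n) g y = \<theta> ^ n * g y"
  using assms(2)
proof (induction n arbitrary: y)
  case (Suc n)
  have "site lam (Suc u) \<noteq> 0" for u by (simp add: site_def)
  then have IH: "(transfer lam ^^ n) g (Suc u) = \<theta> ^ n * g (Suc u)"
    and IH': "site lam u * (transfer lam ^^ n) g u = site lam u * (\<theta> ^ n * g u)" for u
    using Suc.IH[of "Suc u"] Suc.IH[of u] by auto
  have "(transfer lam ^^ Suc n) g y = \<theta> ^ n * transfer lam g y"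
    using IH IH' by (cases y) (simp_all add: transfer_0 transfer_Suc algebra_simps)
  then show ?case using assms(1)[OF Suc.prems] by simp
qed simp

text \<open>Reversibility turns the return weight into a weighted sum of squares, so that any
  eigenfunction yields a lower bound by the Cauchy-Schwarz inequality.\<close>

lemma return_weight_ge:
  assumes lam: "0 \<le> lam" and A: "0 < A"
    and eig: "\<And>y. site lam y \<noteq> 0 \<Longrightarrow> transfer lam g y = \<theta> * g y"
  shows "(\<theta> ^ n * g A)\<^sup>2 \<le> weight lam (2 * n) A A * (\<Sum>u\<le>A + n. site lam u * (g u)\<^sup>2)"
proof -
  have kA: "walk_kernel lam n A u = site lam u * walk_kernel lam n u A" for u
    using weight_sym[of lam n A u] A by (simp add: weight_eq_kernel site_def)
  have "weight lam (2 * n) A A = (transfer lam ^^ n) ((transfer lam ^^ n) (\<lambda>u. of_bool (u = A))) A"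
    using A by (simp add: weight_eq_kernel walk_kernel_def site_def mult_2 funpow_add)
  also have "\<dots> = (\<Sum>u\<le>A + n. walk_kernel lam n A u * walk_kernel lam n u A)"
    by (subst transfer_pow_eq_sum[where M="A + n"]) (auto simp: walk_kernel_def)
  also have "\<dots> = (\<Sum>u\<le>A + n. (sqrt (site lam u) * walk_kernel lam n u A)\<^sup>2)"
    by (intro sum.cong) (auto simp: kA power_mult_distrib site_nonneg[OF lam] power2_eq_square)
  finally have W: "weight lam (2 * n) A A = (\<Sum>u\<le>A + n. (sqrt (site lam u) * walk_kernel lam n u A)\<^sup>2)" .
  have "\<theta> ^ n * g A = (\<Sum>u\<le>A + n. walk_kernel lam n A u * g u)"
    using transfer_pow_eigen[OF eig] A by (subst transfer_pow_eq_sum[symmetric]) (auto simp: site_def)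
  also have "\<dots> = (\<Sum>u\<le>A + n. (sqrt (site lam u) * walk_kernel lam n u A) * (sqrt (site lam u) * g u))"
    using site_nonneg[OF lam] by (intro sum.cong) (auto simp: kA)
  finally have "(\<theta> ^ n * g A)\<^sup>2 =
      (\<Sum>u\<le>A + n. (sqrt (site lam u) * walk_kernel lam n u A) * (sqrt (site lam u) * g u))\<^sup>2" by simp
  also have "\<dots> \<le> (\<Sum>u\<le>A + n. (sqrt (site lam u) * walk_kernel lam n u A)\<^sup>2) *
      (\<Sum>u\<le>A + n. (sqrt (site lam u) * g u)\<^sup>2)"
    by (rule Cauchy_Schwarz_ineq_sum)
  also have "(\<Sum>u\<le>A + n. (sqrt (site lam u) * g u)\<^sup>2) = (\<Sum>u\<le>A + n. site lam u * (g u)\<^sup>2)"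
    by (intro sum.cong) (auto simp: power_mult_distrib site_nonneg[OF lam])
  finally show ?thesis using W by simp
qed

section \<open>Cutting and reversing walks\<close>

definition walk_take :: "nat \<Rightarrow> (nat \<Rightarrow> nat) \<Rightarrow> nat \<Rightarrow> nat" where
  "walk_take x \<eta> = (\<lambda>t. if t \<le> x then \<eta> t else 0)"

definition walk_drop :: "nat \<Rightarrow> (nat \<Rightarrow> nat) \<Rightarrow> nat \<Rightarrow> nat" where
  "walk_drop x \<eta> = (\<lambda>t. \<eta> (x + t))"

definition walk_rev :: "nat \<Rightarrow> (nat \<Rightarrow> nat) \<Rightarrow> nat \<Rightarrow> nat" where
  "walk_rev n \<eta> = (\<lambda>t. if t \<le> n then \<eta> (n - t) else 0)"

definition wsum :: "real \<Rightarrow> nat \<Rightarrow> nat \<Rightarrow> nat \<Rightarrow> ((nat \<Rightarrow> nat) \<Rightarrow> bool) \<Rightarrow> real" where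
  "wsum lam n y z Q = (\<Sum>\<eta>\<in>{\<eta>\<in>walks n y z. Q \<eta>}. lam ^ Hzeros n \<eta>)"

lemma wsum_True: "wsum lam n y z (\<lambda>_. True) = weight lam n y z"
  by (simp add: wsum_def weight_def)

lemma wsum_nonneg: "0 \<le> lam \<Longrightarrow> 0 \<le> wsum lam n y z Q"
  by (auto simp: wsum_def intro!: sum_nonneg)

lemma wsum_mono:
  assumes "0 \<le> lam" and "\<And>\<eta>. \<eta> \<in> walks n y z \<Longrightarrow> Q \<eta> \<Longrightarrow> R \<eta>"
  shows "wsum lam n y z Q \<le> wsum lam n y z R"
  unfolding wsum_def using assms by (intro sum_mono2) auto

lemma wsum_mono_param:
  assumes "0 \<le> lam" and "lam \<le> lam'"
  shows "wsum lam n y z Q \<le> wsum lam' n y z Q"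
  unfolding wsum_def using assms by (intro sum_mono power_mono) auto

lemma wsum_UN:
  assumes "0 \<le> lam" and "finite I"
    and "\<And>\<eta>. \<eta> \<in> walks n y z \<Longrightarrow> Q \<eta> \<Longrightarrow> \<exists>i\<in>I. R i \<eta>"
  shows "wsum lam n y z Q \<le> (\<Sum>i\<in>I. wsum lam n y z (R i))"
proof -
  have "wsum lam n y z Q = (\<Sum>\<eta>\<in>walks n y z. of_bool (Q \<eta>) * lam ^ Hzeros n \<eta>)"
    unfolding wsum_def by (intro sum.mono_neutral_cong_left) auto
  also have "\<dots> \<le> (\<Sum>\<eta>\<in>walks n y z. (\<Sum>i\<in>I. of_bool (R i \<eta>)) * lam ^ Hzeros n \<eta>)"
  proof (intro sum_mono mult_right_mono)
    fix \<eta> assume \<eta>: "\<eta> \<in> walks n y z"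
    show "of_bool (Q \<eta>) \<le> (\<Sum>i\<in>I. of_bool (R i \<eta>) :: real)"
    proof (cases "Q \<eta>")
      case True
      then obtain i where "i \<in> I" "R i \<eta>" using assms(3) \<eta> by blast
      then show ?thesis
        using member_le_sum[of i I "\<lambda>i. of_bool (R i \<eta>) :: real"] assms(2) True by simp
    qed (simp add: sum_nonneg)
  qed (use assms in auto)
  also have "\<dots> = (\<Sum>i\<in>I. \<Sum>\<eta>\<in>walks n y z. of_bool (R i \<eta>) * lam ^ Hzeros n \<eta>)"
    unfolding sum_distrib_right by (rule sum.swap)
  also have "\<dots> = (\<Sum>i\<in>I. wsum lam n y z (R i))"
    unfolding wsum_def by (intro sum.cong refl sum.mono_neutral_cong_right) auto
  finally show ?thesis .
qed

lemma wsum_disj: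
  assumes "0 \<le> lam"
  shows "wsum lam n y z (\<lambda>\<eta>. Q \<eta> \<or> R \<eta>) \<le> wsum lam n y z Q + wsum lam n y z R"
proof -
  have "wsum lam n y z (\<lambda>\<eta>. Q \<eta> \<or> R \<eta>) \<le>
      (\<Sum>b\<in>{True, False}. wsum lam n y z (if b then Q else R))"
    using assms by (intro wsum_UN) auto
  then show ?thesis by simp
qed

lemma walk_height_le:
  assumes "\<eta> \<in> walks n y z" and "t \<le> n"
  shows "\<eta> t \<le> y + t"
  using assms(2)
proof (induction t)
  case (Suc t)
  then have "\<bar>int (\<eta> (t + 1)) - int (\<eta> t)\<bar> = 1" using assms(1) by (auto simp: walks_def)
  with Suc show ?case by simp
qed (use assms(1) in \<open>simp add: walks_def\<close>)

lemma walk_rev_walk_rev: "\<eta> \<in> walks n y z \<Longrightarrow> walk_rev n (walk_rev n \<eta>) = \<eta>"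
  by (auto simp: walk_rev_def walks_def fun_eq_iff)

lemma walk_rev_in_walks:
  assumes "\<eta> \<in> walks n y z"
  shows "walk_rev n \<eta> \<in> walks n z y"
proof -
  have "\<bar>int (\<eta> (n - Suc x)) - int (\<eta> (n - x))\<bar> = 1" if "x < n" for x
  proof -
    have "\<bar>int (\<eta> (n - Suc x + 1)) - int (\<eta> (n - Suc x))\<bar> = 1"
      using assms that unfolding walks_def by auto
    moreover have "n - Suc x + 1 = n - x" using that by simp
    ultimately show ?thesis by (metis abs_minus_commute)
  qed
  then show ?thesis using assms by (auto simp: walks_def walk_rev_def)
qed

lemma Hzeros_walk_rev: "Hzeros n (walk_rev n \<eta>) = Hzeros n \<eta>"
proof -
  have "bij_betw (\<lambda>t. n - t) {x. x \<le> n \<and> walk_rev n \<eta> x = 0} {x. x \<le> n \<and> \<eta> x = 0}"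
    by (rule bij_betwI[where g="\<lambda>t. n - t"]) (auto simp: walk_rev_def)
  then show ?thesis unfolding Hzeros_def by (rule bij_betw_same_card)
qed

lemma wsum_walk_rev: "wsum lam n y z (\<lambda>\<eta>. Q (walk_rev n \<eta>)) = wsum lam n z y Q"
  unfolding wsum_def
  by (rule sum.reindex_bij_witness[where i="walk_rev n" and j="walk_rev n"])
     (auto simp: walk_rev_walk_rev walk_rev_in_walks Hzeros_walk_rev)

lemma walk_take_in_walks:
  "\<eta> \<in> walks n y z \<Longrightarrow> x \<le> n \<Longrightarrow> walk_take x \<eta> \<in> walks x y (\<eta> x)"
  by (auto simp: walks_def walk_take_def)

lemma walk_drop_in_walks:
  "\<eta> \<in> walks n y z \<Longrightarrow> x \<le> n \<Longrightarrow> walk_drop x \<eta> \<in> walks (n - x) (\<eta> x) z"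
  by (auto simp: walks_def walk_drop_def)

lemma inj_take_drop: "inj (\<lambda>\<eta>. (walk_take x \<eta>, walk_drop x \<eta>))"
proof (rule injI)
  fix \<eta> \<zeta> assume "(walk_take x \<eta>, walk_drop x \<eta>) = (walk_take x \<zeta>, walk_drop x \<zeta>)"
  then have 1: "walk_take x \<eta> t = walk_take x \<zeta> t" and 2: "walk_drop x \<eta> t = walk_drop x \<zeta> t" for t
    by auto
  show "\<eta> = \<zeta>"
  proof
    fix t show "\<eta> t = \<zeta> t"
      using 1[of t] 2[of "t - x"] by (cases "t \<le> x") (auto simp: walk_take_def walk_drop_def)
  qed
qed

lemma sum_walks_split:
  fixes F G G' :: "(nat \<Rightarrow> nat) \<Rightarrow> real"
  assumes x: "x \<le> n" and G: "\<And>\<eta>. 0 \<le> G \<eta>" and G': "\<And>\<eta>. 0 \<le> G' \<eta>"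
    and S: "\<And>\<eta>. \<eta> \<in> S \<Longrightarrow> \<eta> \<in> walks n y z \<and> \<eta> x = u \<and> Q (walk_drop x \<eta>)"
    and F: "\<And>\<eta>. \<eta> \<in> S \<Longrightarrow> F \<eta> \<le> G (walk_take x \<eta>) * G' (walk_drop x \<eta>)"
  shows "(\<Sum>\<eta>\<in>S. F \<eta>) \<le> (\<Sum>\<eta>\<in>walks x y u. G \<eta>) * (\<Sum>\<eta>\<in>{\<eta>\<in>walks (n - x) u z. Q \<eta>}. G' \<eta>)"
proof -
  let ?j = "\<lambda>\<eta>. (walk_take x \<eta>, walk_drop x \<eta>)"
  have inj: "inj_on ?j S" using inj_take_drop inj_on_subset by blast
  have "(\<Sum>\<eta>\<in>S. F \<eta>) \<le> (\<Sum>\<eta>\<in>S. (\<lambda>(\<eta>,\<zeta>). G \<eta> * G' \<zeta>) (?j \<eta>))"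
    using F by (intro sum_mono) auto
  also have "\<dots> = (\<Sum>(\<eta>,\<zeta>)\<in>?j ` S. G \<eta> * G' \<zeta>)"
    by (subst sum.reindex[OF inj]) (simp add: o_def)
  also have "\<dots> \<le> (\<Sum>(\<eta>,\<zeta>)\<in>walks x y u \<times> {\<eta>\<in>walks (n - x) u z. Q \<eta>}. G \<eta> * G' \<zeta>)"
    using S x G G' walk_take_in_walks walk_drop_in_walks
    by (intro sum_mono2) (fastforce intro!: mult_nonneg_nonneg)+
  also have "\<dots> = (\<Sum>\<eta>\<in>walks x y u. G \<eta>) * (\<Sum>\<eta>\<in>{\<eta>\<in>walks (n - x) u z. Q \<eta>}. G' \<eta>)"
    by (simp add: sum_product sum.cartesian_product)
  finally show ?thesis .
qed

lemma Hzeros_split_le: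
  assumes "x \<le> n"
  shows "Hzeros n \<eta> \<le> card {t. t < x \<and> \<eta> t = 0} + Hzeros (n - x) (walk_drop x \<eta>)"
proof -
  have "{t. t \<le> n \<and> \<eta> t = 0} \<subseteq>
      {t. t < x \<and> \<eta> t = 0} \<union> (\<lambda>t. x + t) ` {t. t \<le> n - x \<and> walk_drop x \<eta> t = 0}"
  proof
    fix t assume t: "t \<in> {t. t \<le> n \<and> \<eta> t = 0}"
    show "t \<in> {t. t < x \<and> \<eta> t = 0} \<union> (\<lambda>t. x + t) ` {t. t \<le> n - x \<and> walk_drop x \<eta> t = 0}"
    proof (cases "t < x")
      case False
      then have "t = x + (t - x)" "t - x \<le> n - x" using t by auto
      then show ?thesis using t by (auto simp: walk_drop_def intro!: image_eqI[where x="t - x"])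
    qed (use t in simp)
  qed
  then have "Hzeros n \<eta> \<le>
      card ({t. t < x \<and> \<eta> t = 0} \<union> (\<lambda>t. x + t) ` {t. t \<le> n - x \<and> walk_drop x \<eta> t = 0})"
    unfolding Hzeros_def by (intro card_mono) auto
  also have "\<dots> \<le> card {t. t < x \<and> \<eta> t = 0} + card ((\<lambda>t. x + t) ` {t. t \<le> n - x \<and> walk_drop x \<eta> t = 0})"
    by (rule card_Un_le)
  also have "\<dots> \<le> card {t. t < x \<and> \<eta> t = 0} + Hzeros (n - x) (walk_drop x \<eta>)"
    unfolding Hzeros_def by (intro add_mono card_image_le) auto
  finally show ?thesis .
qed

lemma wsum_split:
  assumes lam: "1 \<le> lam" and x: "x \<le> n"
  shows "wsum lam n y z (\<lambda>\<eta>. \<eta> x = u \<and> Q (walk_drop x \<eta>))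
      \<le> weight lam x y u * wsum lam (n - x) u z Q"
  unfolding wsum_def weight_def
proof (rule sum_walks_split[OF x])
  fix \<eta>
  have "Hzeros n \<eta> \<le> Hzeros x (walk_take x \<eta>) + Hzeros (n - x) (walk_drop x \<eta>)"
    using Hzeros_split_le[OF x, of \<eta>]
      card_mono[of "{t. t \<le> x \<and> walk_take x \<eta> t = 0}" "{t. t < x \<and> \<eta> t = 0}"]
    by (auto simp: Hzeros_def walk_take_def Collect_mono_iff)
  then show "lam ^ Hzeros n \<eta> \<le> lam ^ Hzeros x (walk_take x \<eta>) * lam ^ Hzeros (n - x) (walk_drop x \<eta>)"
    using lam by (metis power_add power_increasing)
qed (use lam in auto)

lemma wsum_split_nozero:
  assumes lam: "1 \<le> lam" and x: "x \<le> n"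
  shows "wsum lam n y z (\<lambda>\<eta>. (\<forall>t<x. \<eta> t \<noteq> 0) \<and> \<eta> x = u \<and> Q (walk_drop x \<eta>))
      \<le> weight 1 x y u * wsum lam (n - x) u z Q"
  unfolding wsum_def weight_def
proof (rule sum_walks_split[OF x])
  fix \<eta> assume "\<eta> \<in> {\<eta> \<in> walks n y z. (\<forall>t<x. \<eta> t \<noteq> 0) \<and> \<eta> x = u \<and> Q (walk_drop x \<eta>)}"
  then have nz: "\<And>t. t < x \<Longrightarrow> \<eta> t \<noteq> 0" by auto
  then have "{t. t < x \<and> \<eta> t = 0} = {}" by auto
  then have "Hzeros n \<eta> \<le> Hzeros (n - x) (walk_drop x \<eta>)"
    using Hzeros_split_le[OF x, of \<eta>] by (simp only: card.empty add_0)
  then show "lam ^ Hzeros n \<eta> \<le> 1 ^ Hzeros x (walk_take x \<eta>) * lam ^ Hzeros (n - x) (walk_drop x \<eta>)"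
    using lam by (simp add: power_increasing)
qed (use lam in auto)

lemma wsum_at_le:
  assumes "1 \<le> lam" and "x \<le> n"
  shows "wsum lam n y z (\<lambda>\<eta>. \<eta> x = u) \<le> weight lam x y u * weight lam (n - x) u z"
  using wsum_split[OF assms, of y z u "\<lambda>_. True"] by (simp add: wsum_True)

lemma wsum_at_at_at_le:
  assumes lam: "1 \<le> lam" and "k \<le> x" "x \<le> l" "l \<le> n"
  shows "wsum lam n y z (\<lambda>\<eta>. \<eta> k = v \<and> \<eta> x = u \<and> \<eta> l = w)
      \<le> weight lam k y v * (weight lam (x - k) v u * (weight lam (l - x) u w * weight lam (n - l) w z))"
proof -
  have "wsum lam (n - x) u z (\<lambda>\<eta>. \<eta> (l - x) = w) \<le> weight lam (l - x) u w * weight lam (n - l) w z"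
    using wsum_at_le[OF lam, of "l - x" "n - x" u z w] assms by simp
  moreover have "wsum lam (n - k) v z (\<lambda>\<eta>. \<eta> (x - k) = u \<and> \<eta> (l - k) = w)
      \<le> weight lam (x - k) v u * wsum lam (n - x) u z (\<lambda>\<eta>. \<eta> (l - x) = w)"
    using wsum_split[OF lam, of "x - k" "n - k" v z u "\<lambda>\<eta>. \<eta> (l - x) = w"] assms
    by (simp add: walk_drop_def)
  moreover have "wsum lam n y z (\<lambda>\<eta>. \<eta> k = v \<and> \<eta> x = u \<and> \<eta> l = w)
      \<le> weight lam k y v * wsum lam (n - k) v z (\<lambda>\<eta>. \<eta> (x - k) = u \<and> \<eta> (l - k) = w)"
    using wsum_split[OF lam, of k n y z v "\<lambda>\<eta>. \<eta> (x - k) = u \<and> \<eta> (l - k) = w"] assms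
    by (simp add: walk_drop_def)
  ultimately show ?thesis
    using lam by (meson mult_left_mono order_trans weight_nonneg zero_le_one)
qed

lemma wsum_nozero_at_at_le:
  assumes lam: "1 \<le> lam" and "x \<le> l" "l \<le> n"
  shows "wsum lam n y z (\<lambda>\<eta>. (\<forall>t<x. \<eta> t \<noteq> 0) \<and> \<eta> x = u \<and> \<eta> l = w)
      \<le> weight 1 x y u * (weight lam (l - x) u w * weight lam (n - l) w z)"
proof -
  have "wsum lam (n - x) u z (\<lambda>\<eta>. \<eta> (l - x) = w) \<le> weight lam (l - x) u w * weight lam (n - l) w z"
    using wsum_at_le[OF lam, of "l - x" "n - x" u z w] assms by simp
  moreover have "wsum lam n y z (\<lambda>\<eta>. (\<forall>t<x. \<eta> t \<noteq> 0) \<and> \<eta> x = u \<and> \<eta> l = w)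
      \<le> weight 1 x y u * wsum lam (n - x) u z (\<lambda>\<eta>. \<eta> (l - x) = w)"
    using wsum_split_nozero[of lam x n y z u "\<lambda>\<eta>. \<eta> (l - x) = w"] assms
    by (simp add: walk_drop_def)
  ultimately show ?thesis
    using lam by (meson mult_left_mono order_trans weight_nonneg zero_le_one)
qed

lemma wsum_nozero_le:
  "wsum lam n y z (\<lambda>\<eta>. (\<forall>t\<le>n. \<eta> t \<noteq> 0) \<and> Q \<eta>) \<le> wsum 1 n y z Q"
proof -
  have "wsum lam n y z (\<lambda>\<eta>. (\<forall>t\<le>n. \<eta> t \<noteq> 0) \<and> Q \<eta>)
      = wsum 1 n y z (\<lambda>\<eta>. (\<forall>t\<le>n. \<eta> t \<noteq> 0) \<and> Q \<eta>)"
    unfolding wsum_def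
  proof (intro sum.cong refl)
    fix \<eta> assume "\<eta> \<in> {\<eta> \<in> walks n y z. (\<forall>t\<le>n. \<eta> t \<noteq> 0) \<and> Q \<eta>}"
    then have "{t. t \<le> n \<and> \<eta> t = 0} = {}" by auto
    then have "Hzeros n \<eta> = 0" by (simp add: Hzeros_def)
    then show "lam ^ Hzeros n \<eta> = 1 ^ Hzeros n \<eta>" by simp
  qed
  also have "\<dots> \<le> wsum 1 n y z Q" by (intro wsum_mono) auto
  finally show ?thesis .
qed

section \<open>Estimates for the weights\<close>

lemma exp_le_quadratic:
  fixes x :: real
  assumes "\<bar>x\<bar> \<le> 1"
  shows "exp x \<le> 1 + x + x\<^sup>2"
proof (cases "0 \<le> x")
  case True
  then show ?thesis using exp_bound assms by auto
next
  case False
  have "1 - x \<le> exp (- x)" using exp_ge_add_one_self[of "- x"] by simp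
  then have "exp x \<le> 1 / (1 - x)" using False by (simp add: exp_minus field_simps)
  also have "1 \<le> (1 + x + x\<^sup>2) * (1 - x)"
  proof -
    have "(1 + x + x\<^sup>2) * (1 - x) = 1 + (- x) * x\<^sup>2" by (simp add: algebra_simps power2_eq_square)
    moreover have "0 \<le> (- x) * x\<^sup>2" using False by (intro mult_nonneg_nonneg) auto
    ultimately show ?thesis by linarith
  qed
  then have "1 / (1 - x) \<le> 1 + x + x\<^sup>2" using False by (simp add: divide_le_eq)
  finally show ?thesis .
qed

lemma free_weight_le:
  assumes s: "0 < s"
  shows "weight 1 n y u * s ^ u \<le> (s + 1 / s) ^ n * s ^ y"
proof -
  have "transfer 1 (\<lambda>y. s ^ y) y \<le> (s + 1 / s) * s ^ y" for y
    using s by (cases y) (auto simp: transfer_0 transfer_Suc site_def field_simps)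
  from walk_kernel_supersolution[of 1 "\<lambda>y. s ^ y", OF _ _ this] show ?thesis
    using s by (auto simp: weight_eq_kernel site_def)
qed

text \<open>Chernoff bound: tilting by \<open>r\<close> gives the walk the drift \<open>- (1 - r\<^sup>2) / (1 + r\<^sup>2)\<close>.\<close>

lemma free_weight_deviation:
  fixes r \<delta> :: real
  assumes r: "0 < r" and \<delta>: "\<bar>\<delta>\<bar> \<le> 1" and d: "d = (1 - r\<^sup>2) / (1 + r\<^sup>2)"
  shows "weight 1 n y u * r ^ u
      \<le> (r + 1 / r) ^ n * r ^ y * exp (\<delta>\<^sup>2 * real n - \<delta> * (real u - real y + d * real n))"
proof -
  let ?s = "r * exp \<delta>"
  have pos: "0 < r + 1 / r" using r by (simp add: add_pos_pos)
  have rr: "1 + r\<^sup>2 \<noteq> 0" using r by (metis add_pos_pos less_irrefl zero_less_one zero_less_power)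
  have "?s + 1 / ?s = r * exp \<delta> + (1 / r) * exp (- \<delta>)" by (simp add: exp_minus field_simps)
  also have "\<dots> \<le> r * (1 + \<delta> + \<delta>\<^sup>2) + (1 / r) * (1 + (- \<delta>) + (- \<delta>)\<^sup>2)"
    using r \<delta> by (intro add_mono mult_left_mono exp_le_quadratic) auto
  also have "\<dots> = (r + 1 / r) * (1 + (\<delta>\<^sup>2 - d * \<delta>))"
    using r rr unfolding d by (simp add: divide_simps) (simp add: algebra_simps power2_eq_square)
  also have "\<dots> \<le> (r + 1 / r) * exp (\<delta>\<^sup>2 - d * \<delta>)"
    using pos exp_ge_add_one_self by (intro mult_left_mono) auto
  finally have le: "?s + 1 / ?s \<le> (r + 1 / r) * exp (\<delta>\<^sup>2 - d * \<delta>)" .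
  have "weight 1 n y u * ?s ^ u \<le> (?s + 1 / ?s) ^ n * ?s ^ y"
    using r by (intro free_weight_le) auto
  also have "\<dots> \<le> ((r + 1 / r) * exp (\<delta>\<^sup>2 - d * \<delta>)) ^ n * ?s ^ y"
    using le r by (intro mult_right_mono power_mono) (auto intro: add_nonneg_nonneg)
  finally have "weight 1 n y u * r ^ u * exp (\<delta> * real u)
      \<le> (r + 1 / r) ^ n * r ^ y * exp ((\<delta>\<^sup>2 - d * \<delta>) * real n + \<delta> * real y)"
    unfolding power_mult_distrib exp_of_nat2_mult[symmetric] exp_add by (simp only: ac_simps)
  then have "weight 1 n y u * r ^ u
      \<le> (r + 1 / r) ^ n * r ^ y * exp ((\<delta>\<^sup>2 - d * \<delta>) * real n + \<delta> * real y) / exp (\<delta> * real u)"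
    by (simp add: pos_le_divide_eq)
  also have "\<dots> = (r + 1 / r) ^ n * r ^ y * exp (\<delta>\<^sup>2 * real n - \<delta> * (real u - real y + d * real n))"
    by (simp add: exp_diff[symmetric] times_divide_eq_right[symmetric] algebra_simps
        del: times_divide_eq_right)
  finally show ?thesis .
qed

lemma free_weight_large_deviation:
  fixes r e :: real
  assumes r: "0 < r" and e: "0 < e" "e \<le> 1" and d: "d = (1 - r\<^sup>2) / (1 + r\<^sup>2)"
    and n: "n \<le> N" and dev: "e * real N \<le> \<bar>real u - real y + d * real n\<bar>"
  shows "weight 1 n y u * r ^ u \<le> (r + 1 / r) ^ n * r ^ y * exp (- (e\<^sup>2 / 4) * real N)"
proof -
  let ?D = "real u - real y + d * real n"
  define \<delta> where "\<delta> = (if 0 \<le> ?D then e / 2 else - (e / 2))"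
  have \<delta>: "\<bar>\<delta>\<bar> \<le> 1" "\<delta>\<^sup>2 = e\<^sup>2 / 4" "\<delta> * ?D = e / 2 * \<bar>?D\<bar>"
    using e by (auto simp: \<delta>_def power2_eq_square abs_if algebra_simps)
  have "\<delta>\<^sup>2 * real n - \<delta> * ?D \<le> e\<^sup>2 / 4 * real N - e / 2 * (e * real N)"
    unfolding \<delta> using e n dev by (intro diff_mono mult_left_mono) auto
  also have "\<dots> = - (e\<^sup>2 / 4) * real N" by (simp add: power2_eq_square)
  finally have "exp (\<delta>\<^sup>2 * real n - \<delta> * ?D) \<le> exp (- (e\<^sup>2 / 4) * real N)" by simp
  moreover have "0 \<le> (r + 1 / r) ^ n * r ^ y" using r by (auto intro!: mult_nonneg_nonneg)
  ultimately show ?thesis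
    using free_weight_deviation[OF r \<delta>(1) d, of n y u]
    by (meson mult_left_mono order_trans)
qed

lemma free_kernel_le_binomial:
  "z + 2 * j = y + n \<Longrightarrow> walk_kernel 1 n y z \<le> real (n choose j)"
proof (induction n arbitrary: y j)
  case 0
  then show ?case by (cases j) (auto simp: walk_kernel_0)
next
  case (Suc n)
  have 1: "walk_kernel 1 n (Suc y) z \<le> real (n choose j)" using Suc by simp
  show ?case
  proof (cases j)
    case 0
    with Suc.prems have "walk_kernel 1 n (y - 1) z = 0" if "y \<noteq> 0"
      using that by (intro walk_kernel_eq_0) simp
    with 1 0 show ?thesis by (cases "y = 0") (simp_all add: walk_kernel_Suc)
  next
    case (Suc i)
    have "walk_kernel 1 n (y - 1) z \<le> real (n choose i)" if "y \<noteq> 0"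
      using Suc Suc.prems that by (intro Suc.IH) simp
    with 1 Suc show ?thesis by (auto simp: walk_kernel_Suc site_def add_increasing2)
  qed
qed

lemma free_return_weight_le: "weight 1 (2 * n) A A \<le> real (2 * n choose n)"
  using free_kernel_le_binomial[of A n A "2 * n"] by (simp add: weight_eq_kernel site_def)

lemma free_weight_le_pow2: "weight 1 n y u \<le> 2 ^ n"
  using free_weight_le[of 1 n y u] by simp

lemma central_binomial_square_le: "(2 * n choose n)\<^sup>2 * (2 * n + 1) \<le> 16 ^ n"
proof (induction n)
  case (Suc n)
  let ?c = "2 * n choose n" and ?c' = "2 * Suc n choose Suc n"
  have a: "Suc n * ?c' = 2 * Suc n * (Suc (2 * n) choose n)"
    using Suc_times_binomial_eq[of "Suc (2 * n)" n] by (simp add: ac_simps)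
  have "(Suc n) * (Suc (2 * n) choose n) = (Suc (2 * n)) * ?c"
  proof -
    have "Suc (2 * n) choose n = Suc (2 * n) choose Suc n"
      using binomial_symmetric[of n "Suc (2 * n)"] by simp
    then show ?thesis using Suc_times_binomial_eq[of "2 * n" n] by (simp add: ac_simps)
  qed
  then have c': "Suc n * ?c' = 2 * (2 * n + 1) * ?c" using a by simp
  have "(Suc n)\<^sup>2 * (?c'\<^sup>2 * (2 * Suc n + 1)) = (Suc n * ?c')\<^sup>2 * (2 * n + 3)"
    unfolding power_mult_distrib by (simp add: algebra_simps del: binomial_Suc_Suc)
  also have "\<dots> = (?c\<^sup>2 * (2 * n + 1)) * (4 * (2 * n + 1) * (2 * n + 3))"
    unfolding c' by (simp add: power2_eq_square algebra_simps)
  also have "\<dots> \<le> 16 ^ n * (16 * (Suc n)\<^sup>2)"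
    using Suc by (rule mult_le_mono) (simp add: power2_eq_square algebra_simps)
  finally have "(Suc n)\<^sup>2 * (?c'\<^sup>2 * (2 * Suc n + 1)) \<le> (Suc n)\<^sup>2 * 16 ^ Suc n" by (simp add: ac_simps)
  then show ?case by (simp only: mult_le_cancel1) simp
qed simp

lemma central_binomial_ratio_tendsto_0: "(\<lambda>n. real (2 * n choose n) / 4 ^ n) \<longlonglongrightarrow> 0"
proof (rule tendsto_sandwich[where f="\<lambda>_. 0"])
  have "real (2 * n choose n) / 4 ^ n \<le> sqrt (1 / real (2 * n + 1))" for n
  proof (rule real_le_rsqrt)
    have "(real (2 * n choose n))\<^sup>2 * real (2 * n + 1) \<le> 16 ^ n"
      using central_binomial_square_le[of n] by (metis of_nat_le_iff of_nat_mult of_nat_power of_nat_numeral)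
    moreover have "(4 ^ n)\<^sup>2 = (16 :: real) ^ n" by (simp add: power2_eq_square power_mult_distrib[symmetric])
    ultimately show "(real (2 * n choose n) / 4 ^ n)\<^sup>2 \<le> 1 / real (2 * n + 1)"
      by (simp add: power_divide field_simps)
  qed
  then show "\<forall>\<^sub>F n in sequentially. real (2 * n choose n) / 4 ^ n \<le> sqrt (1 / real (2 * n + 1))" by simp
  have "(\<lambda>n. 1 / real (2 * n + 1)) \<longlonglongrightarrow> 0"
    by (rule tendsto_divide_0[OF tendsto_const])
       (intro filterlim_at_top_imp_at_infinity filterlim_compose[OF filterlim_real_sequentially]
         filterlim_subseq strict_monoI, simp)
  then have "(\<lambda>n. sqrt (1 / real (2 * n + 1))) \<longlonglongrightarrow> sqrt 0" by (rule tendsto_real_sqrt)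
  then show "(\<lambda>n. sqrt (1 / real (2 * n + 1))) \<longlonglongrightarrow> 0" by simp
qed simp_all

lemma positive_return_weight_ge:
  assumes A: "0 < A"
  shows "4 ^ n \<le> weight 0 (2 * n) A A * (real (A + n + 1)) ^ 3"
proof -
  have "transfer 0 real y = 2 * real y" if "site 0 y \<noteq> 0" for y
    using that by (cases y) (auto simp: transfer_Suc site_def)
  from return_weight_ge[of 0 A real, OF _ A this]
  have 1: "(2 ^ n * real A)\<^sup>2 \<le> weight 0 (2 * n) A A * (\<Sum>u\<le>A + n. site 0 u * (real u)\<^sup>2)" by simp
  have "(\<Sum>u\<le>A + n. site 0 u * (real u)\<^sup>2) \<le> (\<Sum>u\<le>A + n. (real (A + n + 1))\<^sup>2)"
    by (intro sum_mono) (auto simp: site_def intro!: power_mono)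
  also have "\<dots> = real (A + n + 1) ^ 3" by (simp add: power2_eq_square power3_eq_cube algebra_simps)
  finally have 2: "(\<Sum>u\<le>A + n. site 0 u * (real u)\<^sup>2) \<le> real (A + n + 1) ^ 3" .
  have "(4::real) ^ n = (2 ^ n)\<^sup>2" by (simp add: power2_eq_square power_mult_distrib[symmetric])
  also have "\<dots> \<le> (2 ^ n * real A)\<^sup>2" using A by (intro power_mono) auto
  also have "\<dots> \<le> weight 0 (2 * n) A A * (real (A + n + 1)) ^ 3"
    using 1 mult_left_mono[OF 2 weight_nonneg[of 0 "2 * n" A A]] by linarith
  finally show ?thesis .
qed

definition pin_eigen :: "real \<Rightarrow> real \<Rightarrow> nat \<Rightarrow> real" where
  "pin_eigen lam r y = (if y = 0 then 1 / lam else r ^ y)"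

lemma transfer_pin_eigen:
  assumes r: "0 < r" and lam: "lam = 1 + 1 / r\<^sup>2"
  shows "transfer lam (pin_eigen lam r) y = (r + 1 / r) * pin_eigen lam r y"
proof -
  have "0 < 1 + 1 / r\<^sup>2" using r by (simp add: add_pos_pos)
  then have lam0: "lam \<noteq> 0" using lam by simp
  have 0: "r = (r + 1 / r) * (1 / lam)"
    using r lam lam0 by (simp add: field_simps power2_eq_square)
  consider "y = 0" | "y = 1" | v where "y = Suc (Suc v)" by (metis One_nat_def not0_implies_Suc)
  then show ?thesis
  proof cases
    case 1
    then show ?thesis using 0 by (simp add: transfer_0 pin_eigen_def)
  next
    case 2
    then show ?thesis using r lam0
      by (simp add: transfer_Suc pin_eigen_def site_def field_simps power2_eq_square)
  next
    case 3
    then show ?thesis using r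
      by (simp add: transfer_Suc pin_eigen_def site_def field_simps power2_eq_square)
  qed
qed

lemma weight_to_zero_le:
  assumes r: "0 < r" and lam: "lam = 1 + 1 / r\<^sup>2"
  shows "weight lam n y 0 \<le> lam\<^sup>2 * ((r + 1 / r) ^ n * r ^ y)"
proof -
  have lam1: "1 \<le> lam" using lam by simp
  have "walk_kernel lam n y 0 * pin_eigen lam r 0 \<le> (r + 1 / r) ^ n * pin_eigen lam r y"
    using r lam1 by (intro walk_kernel_supersolution) (auto simp: transfer_pin_eigen[OF r lam], auto simp: pin_eigen_def)
  also have "\<dots> \<le> (r + 1 / r) ^ n * r ^ y"
    using r lam1 by (intro mult_left_mono) (auto simp: pin_eigen_def)
  finally have "walk_kernel lam n y 0 \<le> lam * ((r + 1 / r) ^ n * r ^ y)"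
    using lam1 by (simp add: pin_eigen_def field_simps)
  moreover have "site lam y \<le> lam" "0 \<le> site lam y" using lam1 by (auto simp: site_def)
  ultimately have "site lam y * walk_kernel lam n y 0 \<le> lam * (lam * ((r + 1 / r) ^ n * r ^ y))"
    using lam1 by (intro mult_mono) (auto simp: walk_kernel_nonneg)
  then show ?thesis by (simp add: weight_eq_kernel power2_eq_square)
qed

lemma weight_from_zero_le:
  assumes "0 < r" and "lam = 1 + 1 / r\<^sup>2"
  shows "weight lam n 0 y \<le> lam\<^sup>2 * ((r + 1 / r) ^ n * r ^ y)"
  using weight_to_zero_le[OF assms] weight_sym[of lam n 0 y] by simp

lemma pinned_return_weight_ge:
  assumes r: "0 < r" "r < 1" and lam: "lam = 1 + 1 / r\<^sup>2" and A: "0 < A"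
  shows "(r + 1 / r) ^ (2 * n) * r ^ (2 * A) * (1 - r\<^sup>2) \<le> weight lam (2 * n) A A"
proof -
  have lam1: "1 \<le> lam" using lam by simp
  have r2: "r\<^sup>2 < 1" "0 < r\<^sup>2" using r by (auto simp: power_less_one_iff)
  have "(\<Sum>u\<le>A + n. site lam u * (pin_eigen lam r u)\<^sup>2) \<le> (\<Sum>u\<le>A + n. (r\<^sup>2) ^ u)"
    using lam1 r by (intro sum_mono)
      (auto simp: site_def pin_eigen_def power2_eq_square power_mult_distrib divide_simps)
  also have "\<dots> = (1 - (r\<^sup>2) ^ Suc (A + n)) / (1 - r\<^sup>2)"
    using r2 sum_gp_basic[of "r\<^sup>2" "A + n"] by (simp add: field_simps)
  also have "\<dots> \<le> 1 / (1 - r\<^sup>2)" using r2 by (intro divide_right_mono) auto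
  finally have S: "(\<Sum>u\<le>A + n. site lam u * (pin_eigen lam r u)\<^sup>2) \<le> 1 / (1 - r\<^sup>2)" .
  have "((r + 1 / r) ^ n * pin_eigen lam r A)\<^sup>2
      \<le> weight lam (2 * n) A A * (\<Sum>u\<le>A + n. site lam u * (pin_eigen lam r u)\<^sup>2)"
    using lam1 A transfer_pin_eigen[OF r(1) lam] by (intro return_weight_ge) auto
  also have "\<dots> \<le> weight lam (2 * n) A A * (1 / (1 - r\<^sup>2))"
    using S weight_nonneg lam1 by (intro mult_left_mono) auto
  finally have "((r + 1 / r) ^ n * r ^ A)\<^sup>2 * (1 - r\<^sup>2) \<le> weight lam (2 * n) A A"
    using A r2 by (simp add: pin_eigen_def pos_le_divide_eq)
  moreover have "0 \<le> weight lam (2 * n) A A" using weight_nonneg lam1 by simp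
  ultimately show ?thesis
    by (simp add: power_mult_distrib power_mult[symmetric] mult.commute)
qed

section \<open>The critical parameter and the deviation events\<close>

lemma lambda_c_properties:
  assumes a: "0 < a" "a < 1 / 2"
  shows "2 < lambda_c a"
    and "\<And>x. 2 < x \<Longrightarrow> x < lambda_c a \<Longrightarrow> Ffree x < a * ln (x - 1)"
    and "\<And>x. lambda_c a \<le> x \<Longrightarrow> a * ln (x - 1) \<le> Ffree x"
proof -
  define h where "h = (\<lambda>x. ln x - ln 2 - (1 / 2 + a) * ln (x - 1))"
  define L where "L = 2 / (1 - 2 * a)"
  have L: "2 < L" using a by (simp add: L_def field_simps)
  have Fh: "Ffree x - a * ln (x - 1) = h x" if "2 < x" for x
    using that by (simp add: Ffree_def h_def ln_div ln_mult ln_sqrt field_simps)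
  have deriv: "(h has_real_derivative ((1 - 2 * a) * x - 2) / (2 * x * (x - 1))) (at x)" if "2 \<le> x" for x
    unfolding h_def using that
    by (auto intro!: derivative_eq_intros simp: divide_simps) (simp add: algebra_simps)
  have cont: "continuous_on {x..y} h" if "2 \<le> x" for x y
    using that by (intro continuous_at_imp_continuous_on) (auto intro!: DERIV_isCont[OF deriv])
  have sgn_neg: "((1 - 2 * a) * x - 2) / (2 * x * (x - 1)) < 0" if "2 < x" "x < L" for x
    using that a by (intro divide_neg_pos) (auto simp: L_def field_simps)
  have sgn_pos: "0 < ((1 - 2 * a) * x - 2) / (2 * x * (x - 1))" if "L < x" for x
  proof (rule divide_pos_pos)
    show "0 < (1 - 2 * a) * x - 2" using that a by (simp add: L_def field_simps)
    show "0 < 2 * x * (x - 1)" using that L by simp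
  qed
  have dec: "h x < 0" if "2 < x" "x \<le> L" for x
  proof -
    have "h x < h 2"
    proof (rule DERIV_neg_imp_decreasing_open[where f=h])
      fix u assume "2 < u" "u < x"
      then show "\<exists>y. (h has_real_derivative y) (at u) \<and> y < 0"
        using deriv[of u] sgn_neg[of u] that by auto
    qed (use that cont in auto)
    then show ?thesis by (simp add: h_def)
  qed
  have inc: "h x < h y" if "L \<le> x" "x < y" for x y
  proof (rule DERIV_pos_imp_increasing_open[where f=h])
    fix u assume "x < u" "u < y"
    then show "\<exists>y. (h has_real_derivative y) (at u) \<and> 0 < y"
      using deriv[of u] sgn_pos[of u] that L by auto
  qed (use that L cont in auto)
  define X where "X = max L (exp ((ln 2 + 1) / (1 / 2 - a)))"
  have X: "L \<le> X" "2 < X" using L by (auto simp: X_def)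
  have "(ln 2 + 1) / (1 / 2 - a) \<le> ln X"
    using X by (subst ln_ge_iff) (auto simp: X_def)
  then have "ln 2 + 1 \<le> ln X * (1 / 2 - a)" using a by (subst (asm) pos_divide_le_eq) auto
  moreover have "(1 / 2 + a) * ln (X - 1) \<le> (1 / 2 + a) * ln X" using X a by (intro mult_left_mono) auto
  ultimately have "0 \<le> h X" unfolding h_def by (simp add: algebra_simps)
  then obtain c where c: "L \<le> c" "h c = 0"
    using IVT'[of h L 0 X] dec[of L] X L cont[of L X] by auto
  have cL: "L < c" using c dec[of L] L by (cases "c = L") auto
  have "lambda_c a = c"
    unfolding lambda_c_def
  proof (rule the_equality)
    show "2 < c \<and> Ffree c = a * ln (c - 1)" using Fh[of c] c cL L by auto
  next
    fix x assume x: "2 < x \<and> Ffree x = a * ln (x - 1)"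
    then have hx: "h x = 0" using Fh[of x] by simp
    then have "L < x" using dec[of x] x by force
    then show "x = c" using inc[of x c] inc[of c x] c hx by (metis less_irrefl less_le_not_le linorder_neqE_linordered_idom order.strict_implies_order)
  qed
  note lc = this
  show "2 < lambda_c a" using lc cL L by simp
  show "Ffree x < a * ln (x - 1)" if "2 < x" "x < lambda_c a" for x
    using Fh[of x] dec[of x] inc[of x c] that c lc by (cases "x \<le> L") auto
  show "a * ln (x - 1) \<le> Ffree x" if "lambda_c a \<le> x" for x
    using Fh[of x] inc[of c x] that c lc cL L by (cases "x = c") auto
qed

lemma pin_parameters:
  assumes lam: "2 < lam" and r: "r = 1 / sqrt (lam - 1)"
  shows "0 < r" "r < 1" "lam = 1 + 1 / r\<^sup>2" "dlam lam = (1 - r\<^sup>2) / (1 + r\<^sup>2)"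
    and "(r + 1 / r) ^ N * r ^ (2 * A) = 2 ^ N * exp (real N * Ffree lam - real A * ln (lam - 1))"
proof -
  have r2: "r\<^sup>2 = 1 / (lam - 1)" using lam r by (simp add: power_divide)
  show r0: "0 < r" and "r < 1" using lam r by auto
  show "lam = 1 + 1 / r\<^sup>2" using r2 lam by simp
  show "dlam lam = (1 - r\<^sup>2) / (1 + r\<^sup>2)" using lam by (simp add: dlam_def r2 field_simps)
  have "r + 1 / r = (r\<^sup>2 + 1) / r" using r0 by (simp add: field_simps power2_eq_square)
  also have "\<dots> = lam / (lam - 1) * sqrt (lam - 1)" using lam unfolding r2 by (simp add: r field_simps)
  also have "\<dots> = lam / sqrt (lam - 1)"
    using lam real_div_sqrt[of "lam - 1"] by (simp add: field_simps)
  also have "\<dots> = 2 * exp (Ffree lam)" using lam by (simp add: Ffree_def)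
  finally have "(r + 1 / r) ^ N = 2 ^ N * exp (real N * Ffree lam)"
    by (simp add: power_mult_distrib exp_of_nat_mult)
  moreover have "r\<^sup>2 = exp (- ln (lam - 1))" using r2 lam by (simp add: exp_minus field_simps)
  then have "r ^ (2 * A) = exp (- real A * ln (lam - 1))"
    by (simp add: power_mult exp_of_nat_mult[symmetric])
  ultimately show "(r + 1 / r) ^ N * r ^ (2 * A) = 2 ^ N * exp (real N * Ffree lam - real A * ln (lam - 1))"
    by (simp add: exp_add[symmetric])
qed

lemma interp_deviation:
  fixes g :: "real \<Rightarrow> real"
  assumes \<eta>: "\<eta> \<in> walks N y z" and e: "0 < e" and N: "4 / e < real N"
    and lip: "\<And>s t. \<bar>g s - g t\<bar> \<le> \<bar>s - t\<bar>"
    and dev: "e \<le> (SUP x\<in>{0..1}. \<bar>interp \<eta> (real N * x) / real N - g x\<bar>)"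
  shows "\<exists>x\<le>N. e / 2 * real N \<le> \<bar>real (\<eta> x) - real N * g (real x / real N)\<bar>"
proof (rule ccontr)
  assume "\<not> ?thesis"
  then have small: "\<bar>real (\<eta> x) - real N * g (real x / real N)\<bar> < e / 2 * real N" if "x \<le> N" for x
    using that by force
  have "0 < 4 / e" using e by simp
  then have N0: "0 < real N" using N by linarith
  have "\<bar>interp \<eta> (real N * t) / real N - g t\<bar> \<le> e / 2 + 2 / real N" if t: "t \<in> {0..1}" for t
  proof -
    define k where "k = nat \<lfloor>real N * t\<rfloor>"
    have Nt: "0 \<le> real N * t" "real N * t \<le> real N"
      using t N0 by (auto simp: mult_left_le)
    have k: "real k \<le> real N * t" "real N * t < real k + 1"
      using Nt by (auto simp: k_def)
    have kN: "k \<le> N" using k Nt by simp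
    have "\<bar>(real N * t - real k) * (real (\<eta> (Suc k)) - real (\<eta> k))\<bar> \<le> 1"
    proof (cases "k < N")
      case True
      then have "\<bar>int (\<eta> (k + 1)) - int (\<eta> k)\<bar> = 1" using \<eta> by (auto simp: walks_def)
      then have "\<bar>real_of_int (int (\<eta> (k + 1)) - int (\<eta> k))\<bar> = 1"
        by (metis of_int_1 of_int_abs)
      then have "\<bar>real (\<eta> (Suc k)) - real (\<eta> k)\<bar> = 1" by simp
      then show ?thesis using k by (simp add: abs_mult)
    next
      case False
      then have "real N * t - real k = 0" using kN Nt k by simp
      then show ?thesis by simp
    qed
    then have "\<bar>interp \<eta> (real N * t) - real (\<eta> k)\<bar> \<le> 1"
      unfolding interp_def Let_def k_def[symmetric] by simp
    moreover have "\<bar>real N * g (real k / real N) - real N * g t\<bar> \<le> 1"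
    proof -
      have "\<bar>real N * g (real k / real N) - real N * g t\<bar> = real N * \<bar>g (real k / real N) - g t\<bar>"
        using N0 by (simp add: right_diff_distrib[symmetric] abs_mult)
      also have "\<dots> \<le> real N * \<bar>real k / real N - t\<bar>" using lip N0 by (intro mult_left_mono) auto
      also have "\<dots> = \<bar>real N * (real k / real N - t)\<bar>" by (simp add: abs_mult)
      also have "\<dots> = \<bar>real k - real N * t\<bar>" using N0 by (simp add: right_diff_distrib)
      also have "\<dots> \<le> 1" using k by simp
      finally show ?thesis .
    qed
    ultimately have "\<bar>interp \<eta> (real N * t) - real N * g t\<bar> \<le> e / 2 * real N + 2"
      using small[OF kN] by linarith
    moreover have "interp \<eta> (real N * t) / real N - g t = (interp \<eta> (real N * t) - real N * g t) / real N"
      using N0 by (simp add: field_simps)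
    ultimately show ?thesis using N0 by (simp add: field_simps)
  qed
  then have "(SUP x\<in>{0..1}. \<bar>interp \<eta> (real N * x) / real N - g x\<bar>) \<le> e / 2 + 2 / real N"
    by (intro cSUP_least) auto
  moreover have "2 / real N < e / 2" using N e N0 by (simp add: field_simps)
  ultimately show False using dev by linarith
qed

lemma fprof_lipschitz:
  assumes "0 \<le> dlam lam" "dlam lam \<le> 1"
  shows "\<bar>fprof a lam s - fprof a lam t\<bar> \<le> \<bar>s - t\<bar>"
proof -
  have "\<bar>dlam lam * s - dlam lam * t\<bar> \<le> \<bar>s - t\<bar>"
    using assms by (simp add: right_diff_distrib[symmetric] abs_mult mult_left_le_one_le)
  moreover have "\<bar>max (a - D) (max 0 (a + (D - b))) - max (a - E) (max 0 (a + (E - b)))\<bar> \<le> c"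
    if "\<bar>D - E\<bar> \<le> c" for b c D E :: real using that by linarith
  ultimately show ?thesis unfolding fprof_def right_diff_distrib mult_1_right by blast
qed

definition pinned_excursion :: "real \<Rightarrow> nat \<Rightarrow> (nat \<Rightarrow> nat) \<Rightarrow> bool" where
  "pinned_excursion e N \<eta> \<longleftrightarrow>
    (\<exists>k x l. k \<le> x \<and> x \<le> l \<and> l \<le> N \<and> \<eta> k = 0 \<and> \<eta> l = 0 \<and> e * real N \<le> real (\<eta> x))"

definition descent_deviation :: "real \<Rightarrow> real \<Rightarrow> real \<Rightarrow> nat \<Rightarrow> (nat \<Rightarrow> nat) \<Rightarrow> bool" where
  "descent_deviation b d e N \<eta> \<longleftrightarrow>
    (\<exists>x l. x \<le> l \<and> l \<le> N \<and> (\<forall>t<x. \<eta> t \<noteq> 0) \<and> \<eta> l = 0 \<and>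
      e * real N \<le> \<bar>real (\<eta> x) - b + d * real x\<bar>)"

text \<open>A walk below the descending line has either not yet touched zero, or it is already below
  the line at its first zero.\<close>

lemma descent_deviation_if_low:
  assumes d: "0 \<le> d" and x: "x \<le> N" and k: "k \<le> N" "\<eta> k = 0"
    and low: "real (\<eta> x) - b + d * real x \<le> - e * real N"
  shows "descent_deviation b d e N \<eta>"
proof -
  define m where "m = (LEAST t. \<eta> t = 0)"
  have m: "\<eta> m = 0" "m \<le> k" "\<And>t. t < m \<Longrightarrow> \<eta> t \<noteq> 0"
    unfolding m_def using k by (auto intro: LeastI Least_le dest: not_less_Least)
  show ?thesis
  proof (cases "x \<le> m")
    case True
    then show ?thesis unfolding descent_deviation_def
      using m k low by (intro exI[of _ x] exI[of _ m]) auto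
  next
    case False
    then have "d * real m \<le> d * real x" using d by (intro mult_left_mono) auto
    then have "real (\<eta> m) - b + d * real m \<le> - e * real N" using low m by simp
    then show ?thesis unfolding descent_deviation_def
      using m k by (intro exI[of _ m] exI[of _ m]) auto
  qed
qed

lemma touching_walk_deviation:
  assumes d: "0 \<le> d" and x: "x \<le> N" and k: "k \<le> N" "\<eta> k = 0" and e: "0 < e" and N: "0 < N"
    and dev: "e * real N \<le>
      \<bar>real (\<eta> x) - max (b - d * real x) (max 0 (b - d * (real N - real x)))\<bar>"
  shows "pinned_excursion e N \<eta> \<or> descent_deviation b d e N \<eta> \<or> descent_deviation b d e N (walk_rev N \<eta>)"
proof -
  have rev: "walk_rev N \<eta> (N - t) = \<eta> t" if "t \<le> N" for t using that by (simp add: walk_rev_def)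
  let ?m = "max (b - d * real x) (max 0 (b - d * (real N - real x)))"
  have eN: "0 < e * real N" using e N by simp
  consider (high) "e * real N \<le> real (\<eta> x) - ?m" | (low) "real (\<eta> x) - ?m \<le> - e * real N"
    using dev by linarith
  then show ?thesis
  proof cases
    case low
    then have "real (\<eta> x) - (b - d * real x) \<le> - e * real N
        \<or> real (\<eta> x) - (b - d * (real N - real x)) \<le> - e * real N"
      using eN by (auto simp: max_def split: if_splits)
    then show ?thesis
    proof
      assume "real (\<eta> x) - (b - d * real x) \<le> - e * real N"
      then have "descent_deviation b d e N \<eta>"
        by (intro descent_deviation_if_low[where x=x and k=k] d x k) (simp add: algebra_simps)
      then show ?thesis by simp
    next
      assume "real (\<eta> x) - (b - d * (real N - real x)) \<le> - e * real N"
      then have "descent_deviation b d e N (walk_rev N \<eta>)"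
        using k x by (intro descent_deviation_if_low[where x="N - x" and k="N - k"] d)
          (auto simp: rev of_nat_diff algebra_simps)
      then show ?thesis by simp
    qed
  next
    case high
    then have h: "e * real N \<le> real (\<eta> x) - b + d * real x" "e * real N \<le> real (\<eta> x)"
      "e * real N \<le> real (\<eta> x) - b + d * (real N - real x)" by (auto simp: max_def split: if_splits)
    consider (mid) i j where "i \<le> x" "x \<le> j" "j \<le> N" "\<eta> i = 0" "\<eta> j = 0"
      | (before) "\<forall>t<x. \<eta> t \<noteq> 0" "x \<le> k" | (after) "\<forall>t. x < t \<and> t \<le> N \<longrightarrow> \<eta> t \<noteq> 0" "k \<le> x"
      using k by (metis le_cases nat_less_le)
    then show ?thesis
    proof cases
      case mid
      then have "pinned_excursion e N \<eta>" unfolding pinned_excursion_def using h by blast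
      then show ?thesis by simp
    next
      case before
      then have "descent_deviation b d e N \<eta>"
        unfolding descent_deviation_def using h k by (intro exI[of _ x] exI[of _ k]) auto
      then show ?thesis by simp
    next
      case after
      have "walk_rev N \<eta> t \<noteq> 0" if "t < N - x" for t using that after by (auto simp: walk_rev_def)
      then have "descent_deviation b d e N (walk_rev N \<eta>)"
        unfolding descent_deviation_def using h k x after
        by (intro exI[of _ "N - x"] exI[of _ "N - k"]) (auto simp: rev of_nat_diff)
      then show ?thesis by simp
    qed
  qed
qed

section \<open>Weights of the deviation events\<close>

lemma card_le_box:
  assumes "I \<subseteq> {..N} \<times> {..N} \<times> {..N} \<times> {..A + N}" and "A \<le> N + 2"
  shows "finite I" "real (card I) \<le> (2 * real N + 3) ^ 4"
proof -
  show "finite I" using assms(1) by (rule finite_subset) auto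
  have "card I \<le> Suc N * (Suc N * (Suc N * Suc (A + N)))"
    using card_mono[OF _ assms(1)] by (simp add: card_cartesian_product)
  also have "\<dots> \<le> (2 * N + 3) * ((2 * N + 3) * ((2 * N + 3) * (2 * N + 3)))"
    using assms(2) by (intro mult_le_mono) auto
  finally have "card I \<le> (2 * N + 3) ^ 4" by (simp add: power4_eq_xxxx mult.assoc)
  then have "real (card I) \<le> real ((2 * N + 3) ^ 4)" by (rule of_nat_mono)
  then show "real (card I) \<le> (2 * real N + 3) ^ 4" by simp
qed

lemma wsum_pinned_excursion_le:
  assumes r: "0 < r" "r < 1" and lam: "lam = 1 + 1 / r\<^sup>2" and A: "A \<le> N + 2" and e: "0 < e"
  shows "wsum lam N A A (pinned_excursion e N)
      \<le> (2 * real N + 3) ^ 4 * (lam ^ 8 * ((r + 1 / r) ^ N * r ^ (2 * A)) * exp (e * ln r * real N))"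
proof -
  define \<theta> where "\<theta> = r + 1 / r"
  have \<theta>: "0 < \<theta>" using r by (simp add: \<theta>_def add_pos_pos)
  have lam1: "1 \<le> lam" using lam by simp
  let ?I = "{(k, x, l, u). k \<le> x \<and> x \<le> l \<and> l \<le> N \<and> u \<le> A + N \<and> e * real N \<le> real u}"
  let ?R = "\<lambda>(k, x, l, u) \<eta>. \<eta> k = 0 \<and> \<eta> x = u \<and> \<eta> l = (0::nat)"
  let ?B = "lam ^ 8 * (\<theta> ^ N * r ^ (2 * A)) * exp (e * ln r * real N)"
  have I: "?I \<subseteq> {..N} \<times> {..N} \<times> {..N} \<times> {..A + N}" by auto
  have "wsum lam N A A (pinned_excursion e N) \<le> (\<Sum>i\<in>?I. wsum lam N A A (?R i))"
  proof (rule wsum_UN)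
    fix \<eta> assume \<eta>: "\<eta> \<in> walks N A A" and "pinned_excursion e N \<eta>"
    then obtain k x l where *: "k \<le> x" "x \<le> l" "l \<le> N" "\<eta> k = 0" "\<eta> l = 0" "e * real N \<le> real (\<eta> x)"
      unfolding pinned_excursion_def by blast
    moreover have "\<eta> x \<le> A + N" using walk_height_le[OF \<eta>, of x] * by simp
    ultimately show "\<exists>i\<in>?I. ?R i \<eta>" by (intro bexI[of _ "(k, x, l, \<eta> x)"]) auto
  qed (use lam1 card_le_box(1)[OF I A] in auto)
  also have "\<dots> \<le> real (card ?I) * ?B"
  proof (rule sum_bounded_above)
    fix i assume "i \<in> ?I"
    then obtain k x l u where i: "i = (k, x, l, u)" and le: "k \<le> x" "x \<le> l" "l \<le> N"
      and u: "e * real N \<le> real u" by auto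
    have "wsum lam N A A (?R i) \<le>
        weight lam k A 0 * (weight lam (x - k) 0 u * (weight lam (l - x) u 0 * weight lam (N - l) 0 A))"
      using wsum_at_at_at_le[OF lam1 le] by (simp add: i)
    also have "\<dots> \<le> (lam\<^sup>2 * (\<theta> ^ k * r ^ A)) * ((lam\<^sup>2 * (\<theta> ^ (x - k) * r ^ u)) *
        ((lam\<^sup>2 * (\<theta> ^ (l - x) * r ^ u)) * (lam\<^sup>2 * (\<theta> ^ (N - l) * r ^ A))))"
      unfolding \<theta>_def using r lam1
      by (intro mult_mono weight_to_zero_le[OF r(1) lam] weight_from_zero_le[OF r(1) lam]
          mult_nonneg_nonneg weight_nonneg) auto
    also have "\<dots> = (lam\<^sup>2 * lam\<^sup>2 * lam\<^sup>2 * lam\<^sup>2) * (\<theta> ^ k * \<theta> ^ (x - k) * \<theta> ^ (l - x) * \<theta> ^ (N - l)) *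
        (r ^ A * r ^ A) * (r ^ u * r ^ u)" by (simp only: ac_simps)
    also have "\<dots> = lam ^ 8 * (\<theta> ^ N * r ^ (2 * A)) * (r ^ u * r ^ u)"
      using le by (simp add: power_add[symmetric] mult_2)
    also have "\<dots> \<le> ?B"
    proof (rule mult_left_mono)
      have "r ^ u * r ^ u \<le> r ^ u" using r by (simp add: mult_left_le power_le_one)
      also have "\<dots> = exp (real u * ln r)" using r by (simp add: exp_of_nat_mult)
      also have "\<dots> \<le> exp (e * ln r * real N)"
        using u r mult_right_mono_neg[OF u, of "ln r"] by (simp add: ac_simps)
      finally show "r ^ u * r ^ u \<le> exp (e * ln r * real N)" .
    qed (use r lam1 \<theta> in auto)
    finally show "wsum lam N A A (?R i) \<le> ?B" .
  qed
  also have "\<dots> \<le> (2 * real N + 3) ^ 4 * ?B"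
    using card_le_box(2)[OF I A] r lam1 \<theta> by (intro mult_right_mono) auto
  finally show ?thesis by (simp add: \<theta>_def)
qed

lemma wsum_descent_deviation_le:
  assumes r: "0 < r" and lam: "lam = 1 + 1 / r\<^sup>2" and A: "A \<le> N + 2" and e: "0 < e" "e \<le> 1"
    and d: "d = (1 - r\<^sup>2) / (1 + r\<^sup>2)"
  shows "wsum lam N A A (descent_deviation (real A) d e N)
      \<le> (2 * real N + 3) ^ 4 * (lam ^ 4 * ((r + 1 / r) ^ N * r ^ (2 * A)) * exp (- (e\<^sup>2 / 4) * real N))"
proof -
  define \<theta> where "\<theta> = r + 1 / r"
  have \<theta>: "0 < \<theta>" using r by (simp add: \<theta>_def add_pos_pos)
  have lam1: "1 \<le> lam" using lam by simp
  let ?I = "{(k::nat, x, l, u). k = 0 \<and> x \<le> l \<and> l \<le> N \<and> u \<le> A + N \<and>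
      e * real N \<le> \<bar>real u - real A + d * real x\<bar>}"
  let ?R = "\<lambda>(k::nat, x, l, u) \<eta>. (\<forall>t<x. \<eta> t \<noteq> 0) \<and> \<eta> x = u \<and> \<eta> l = (0::nat)"
  let ?B = "lam ^ 4 * (\<theta> ^ N * r ^ (2 * A)) * exp (- (e\<^sup>2 / 4) * real N)"
  have I: "?I \<subseteq> {..N} \<times> {..N} \<times> {..N} \<times> {..A + N}" by auto
  have "wsum lam N A A (descent_deviation (real A) d e N) \<le> (\<Sum>i\<in>?I. wsum lam N A A (?R i))"
  proof (rule wsum_UN)
    fix \<eta> assume \<eta>: "\<eta> \<in> walks N A A" and "descent_deviation (real A) d e N \<eta>"
    then obtain x l where *: "x \<le> l" "l \<le> N" "\<forall>t<x. \<eta> t \<noteq> 0" "\<eta> l = 0"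
      "e * real N \<le> \<bar>real (\<eta> x) - real A + d * real x\<bar>"
      unfolding descent_deviation_def by blast
    moreover have "\<eta> x \<le> A + N" using walk_height_le[OF \<eta>, of x] * by simp
    ultimately show "\<exists>i\<in>?I. ?R i \<eta>" by (intro bexI[of _ "(0, x, l, \<eta> x)"]) auto
  qed (use lam1 card_le_box(1)[OF I A] in auto)
  also have "\<dots> \<le> real (card ?I) * ?B"
  proof (rule sum_bounded_above)
    fix i assume "i \<in> ?I"
    then obtain x l u where i: "i = (0, x, l, u)" and le: "x \<le> l" "l \<le> N"
      and u: "e * real N \<le> \<bar>real u - real A + d * real x\<bar>" by auto
    have "wsum lam N A A (?R i) \<le> weight 1 x A u * (weight lam (l - x) u 0 * weight lam (N - l) 0 A)"
      using wsum_nozero_at_at_le[OF lam1 le] by (simp add: i)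
    also have "\<dots> \<le> weight 1 x A u *
        ((lam\<^sup>2 * (\<theta> ^ (l - x) * r ^ u)) * (lam\<^sup>2 * (\<theta> ^ (N - l) * r ^ A)))"
      unfolding \<theta>_def using r lam1
      by (intro mult_mono weight_to_zero_le[OF r lam] weight_from_zero_le[OF r lam]
          mult_nonneg_nonneg weight_nonneg) auto
    also have "\<dots> = (weight 1 x A u * r ^ u) * (lam\<^sup>2 * lam\<^sup>2 * (\<theta> ^ (l - x) * \<theta> ^ (N - l)) * r ^ A)"
      by (simp only: ac_simps)
    also have "\<dots> \<le> (\<theta> ^ x * r ^ A * exp (- (e\<^sup>2 / 4) * real N)) *
        (lam\<^sup>2 * lam\<^sup>2 * (\<theta> ^ (l - x) * \<theta> ^ (N - l)) * r ^ A)"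
      unfolding \<theta>_def using r lam1 le u
      by (intro mult_right_mono free_weight_large_deviation[OF r e d]) auto
    also have "\<dots> = lam\<^sup>2 * lam\<^sup>2 * (\<theta> ^ x * \<theta> ^ (l - x) * \<theta> ^ (N - l)) * (r ^ A * r ^ A) *
        exp (- (e\<^sup>2 / 4) * real N)" by (simp only: ac_simps)
    also have "\<dots> = ?B" using le by (simp add: power_add[symmetric] mult_2)
    finally show "wsum lam N A A (?R i) \<le> ?B" .
  qed
  also have "\<dots> \<le> (2 * real N + 3) ^ 4 * ?B"
    using card_le_box(2)[OF I A] r lam1 \<theta> by (intro mult_right_mono) auto
  finally show ?thesis by (simp add: \<theta>_def)
qed

lemma wsum_touching_le:
  assumes r: "0 < r" and lam: "lam = 1 + 1 / r\<^sup>2"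
  shows "wsum lam N A A (\<lambda>\<eta>. \<exists>k\<le>N. \<eta> k = 0)
      \<le> (real N + 1) * (lam ^ 4 * ((r + 1 / r) ^ N * r ^ (2 * A)))"
proof -
  define \<theta> where "\<theta> = r + 1 / r"
  have \<theta>: "0 < \<theta>" using r by (simp add: \<theta>_def add_pos_pos)
  have lam1: "1 \<le> lam" using lam by simp
  have "wsum lam N A A (\<lambda>\<eta>. \<exists>k\<le>N. \<eta> k = 0) \<le> (\<Sum>k\<in>{..N}. wsum lam N A A (\<lambda>\<eta>. \<eta> k = 0))"
    using lam1 by (intro wsum_UN) auto
  also have "\<dots> \<le> real (card {..N}) * (lam ^ 4 * (\<theta> ^ N * r ^ (2 * A)))"
  proof (rule sum_bounded_above)
    fix k assume "k \<in> {..N}"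
    then have k: "k \<le> N" by simp
    have "wsum lam N A A (\<lambda>\<eta>. \<eta> k = 0) \<le> weight lam k A 0 * weight lam (N - k) 0 A"
      by (rule wsum_at_le[OF lam1 k])
    also have "\<dots> \<le> (lam\<^sup>2 * (\<theta> ^ k * r ^ A)) * (lam\<^sup>2 * (\<theta> ^ (N - k) * r ^ A))"
      unfolding \<theta>_def using r lam1
      by (intro mult_mono weight_to_zero_le[OF r lam] weight_from_zero_le[OF r lam] weight_nonneg) auto
    also have "\<dots> = lam\<^sup>2 * lam\<^sup>2 * (\<theta> ^ k * \<theta> ^ (N - k)) * (r ^ A * r ^ A)" by (simp only: ac_simps)
    also have "\<dots> = lam ^ 4 * (\<theta> ^ N * r ^ (2 * A))"
      using k by (simp add: power_add[symmetric] mult_2)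
    finally show "wsum lam N A A (\<lambda>\<eta>. \<eta> k = 0) \<le> lam ^ 4 * (\<theta> ^ N * r ^ (2 * A))" .
  qed
  finally show ?thesis by (simp add: \<theta>_def add.commute)
qed

lemma wsum_free_deviation_le:
  assumes A: "A \<le> N + 2" and e: "0 < e" "e \<le> 1"
  shows "wsum 1 N A A (\<lambda>\<eta>. \<exists>x\<le>N. e * real N \<le> \<bar>real (\<eta> x) - real A\<bar>)
      \<le> (2 * real N + 3) ^ 4 * (2 ^ N * exp (- (e\<^sup>2 / 4) * real N))"
proof -
  let ?I = "{(k::nat, l::nat, x, u). k = 0 \<and> l = 0 \<and> x \<le> N \<and> u \<le> A + N \<and> e * real N \<le> \<bar>real u - real A\<bar>}"
  let ?R = "\<lambda>(k::nat, l::nat, x, u) \<eta>. \<eta> x = (u::nat)"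
  let ?B = "2 ^ N * exp (- (e\<^sup>2 / 4) * real N)"
  have I: "?I \<subseteq> {..N} \<times> {..N} \<times> {..N} \<times> {..A + N}" by auto
  have "wsum 1 N A A (\<lambda>\<eta>. \<exists>x\<le>N. e * real N \<le> \<bar>real (\<eta> x) - real A\<bar>) \<le> (\<Sum>i\<in>?I. wsum 1 N A A (?R i))"
  proof (rule wsum_UN)
    fix \<eta> assume \<eta>: "\<eta> \<in> walks N A A" and "\<exists>x\<le>N. e * real N \<le> \<bar>real (\<eta> x) - real A\<bar>"
    then obtain x where *: "x \<le> N" "e * real N \<le> \<bar>real (\<eta> x) - real A\<bar>" by blast
    moreover have "\<eta> x \<le> A + N" using walk_height_le[OF \<eta>, of x] * by simp
    ultimately show "\<exists>i\<in>?I. ?R i \<eta>" by (intro bexI[of _ "(0, 0, x, \<eta> x)"]) auto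
  qed (use card_le_box(1)[OF I A] in auto)
  also have "\<dots> \<le> real (card ?I) * ?B"
  proof (rule sum_bounded_above)
    fix i assume "i \<in> ?I"
    then obtain x u where i: "i = (0, 0, x, u)" and x: "x \<le> N"
      and u: "e * real N \<le> \<bar>real u - real A\<bar>" by auto
    have "wsum 1 N A A (?R i) \<le> weight 1 x A u * weight 1 (N - x) u A"
      using wsum_at_le[OF _ x, of 1] by (simp add: i)
    also have "\<dots> \<le> (2 ^ x * exp (- (e\<^sup>2 / 4) * real N)) * 2 ^ (N - x)"
      using free_weight_large_deviation[of 1 e 0 x N u A] e x u
      by (intro mult_mono free_weight_le_pow2 weight_nonneg) auto
    also have "\<dots> = (2 ^ x * 2 ^ (N - x)) * exp (- (e\<^sup>2 / 4) * real N)" by simp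
    also have "\<dots> = ?B" using x by (simp add: power_add[symmetric])
    finally show "wsum 1 N A A (?R i) \<le> ?B" .
  qed
  also have "\<dots> \<le> (2 * real N + 3) ^ 4 * ?B"
    using card_le_box(2)[OF I A] by (intro mult_right_mono) auto
  finally show ?thesis .
qed

lemma poly_exp_tendsto_0:
  fixes c :: real
  assumes "0 < c"
  shows "(\<lambda>n. (2 * real (2 * n) + 3) ^ k * exp (- c * real (2 * n))) \<longlonglongrightarrow> 0"
  using assms by real_asymp

section \<open>The two phases\<close>

definition boundary_height :: "real \<Rightarrow> nat \<Rightarrow> nat" where
  "boundary_height a N = nat (even_ceil (a * real N))"

lemma boundary_height_bounds:
  assumes "0 < a"
  shows "a * real N \<le> real (boundary_height a N)" "real (boundary_height a N) \<le> a * real N + 2"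
    and "int (boundary_height a N) = even_ceil (a * real N)"
proof -
  have "0 \<le> a * real N" using assms by simp
  then have "0 \<le> even_ceil (a * real N)" by (simp add: even_ceil_eq)
  then show *: "int (boundary_height a N) = even_ceil (a * real N)" by (simp add: boundary_height_def)
  have "real (boundary_height a N) = 2 * real_of_int \<lceil>a * real N / 2\<rceil>"
    using * by (metis even_ceil_eq of_int_mult of_int_numeral of_int_of_nat_eq)
  then show "a * real N \<le> real (boundary_height a N)" "real (boundary_height a N) \<le> a * real N + 2"
    by linarith+
qed

lemma boundary_height_le:
  assumes "0 < a" "a < 1 / 2"
  shows "boundary_height a N \<le> N + 2"
proof -
  have "a * real N \<le> real N" using assms by (simp add: mult_left_le_one_le)
  then have "real (boundary_height a N) \<le> real (N + 2)"
    using boundary_height_bounds(2)[OF assms(1), of N] by simp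
  then show ?thesis by (simp only: of_nat_le_iff)
qed

lemma boundary_height_pos:
  assumes "0 < a" "0 < N"
  shows "0 < boundary_height a N"
  using boundary_height_bounds(1)[OF assms(1), of N] mult_pos_pos[of a "real N"] assms by linarith

lemma piN_eq_wsum:
  assumes "0 < a"
  shows "piN N lam a P = wsum lam N (boundary_height a N) (boundary_height a N) P
      / weight lam N (boundary_height a N) (boundary_height a N)"
proof -
  have "paths N a = walks N (boundary_height a N) (boundary_height a N)"
    unfolding paths_def walks_def by (simp add: boundary_height_bounds(3)[OF assms, symmetric])
  then show ?thesis by (simp add: piN_def partfun_def wsum_def weight_def)
qed

lemma descent_deviation_shift:
  assumes "descent_deviation b d e N \<eta>" and "\<bar>b - b'\<bar> \<le> (e - e') * real N"
  shows "descent_deviation b' d e' N \<eta>"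
  using assms unfolding descent_deviation_def left_diff_distrib
  by (elim exE conjE, intro exI conjI) (assumption | linarith)+

lemma profile_deviation_cases:
  assumes a: "0 < a" and lam: "2 < lam" and \<epsilon>: "0 < \<epsilon>" and e: "0 < e" "e \<le> \<epsilon> / 2"
    and N: "4 / \<epsilon> < real N" "4 / e \<le> real N"
    and \<eta>: "\<eta> \<in> walks N y z"
    and dev: "\<epsilon> \<le> (SUP x\<in>{0..1}. \<bar>interp \<eta> (real N * x) / real N - fprof a lam x\<bar>)"
  shows "((\<forall>t\<le>N. \<eta> t \<noteq> 0) \<and> True) \<or> (pinned_excursion e N \<eta> \<or>
    (descent_deviation (boundary_height a N) (dlam lam) (e / 2) N \<eta> \<or>
     descent_deviation (boundary_height a N) (dlam lam) (e / 2) N (walk_rev N \<eta>)))"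
proof (cases "\<forall>t\<le>N. \<eta> t \<noteq> 0")
  case False
  then obtain k where k: "k \<le> N" "\<eta> k = 0" by auto
  have d: "0 \<le> dlam lam" "dlam lam \<le> 1" using lam by (auto simp: dlam_def)
  have "0 < 4 / e" using e by simp
  then have N0: "0 < N" using N by (cases N) auto
  obtain x where x: "x \<le> N" "\<epsilon> / 2 * real N \<le> \<bar>real (\<eta> x) - real N * fprof a lam (real x / real N)\<bar>"
    using interp_deviation[OF \<eta> \<epsilon> N(1) fprof_lipschitz[OF d] dev] by blast
  have lines: "real N * (a - dlam lam * (real x / real N)) = a * real N - dlam lam * real x"
    "real N * (a + dlam lam * (real x / real N - 1)) = a * real N - dlam lam * (real N - real x)"
    using N0 by (simp_all add: field_simps)
  have fp: "real N * fprof a lam (real x / real N)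
      = max (a * real N - dlam lam * real x) (max 0 (a * real N - dlam lam * (real N - real x)))"
    unfolding lines[symmetric] by (simp add: fprof_def max_mult_distrib_left del: times_divide_eq_right)
  have "e * real N \<le> \<epsilon> / 2 * real N" using e by (intro mult_right_mono) auto
  with x fp have "e * real N \<le> \<bar>real (\<eta> x) -
      max (a * real N - dlam lam * real x) (max 0 (a * real N - dlam lam * (real N - real x)))\<bar>" by simp
  from touching_walk_deviation[where \<eta>=\<eta> and x=x and k=k, OF d(1) x(1) k e(1) N0 this]
  have *: "pinned_excursion e N \<eta> \<or> descent_deviation (a * real N) (dlam lam) e N \<eta>
      \<or> descent_deviation (a * real N) (dlam lam) e N (walk_rev N \<eta>)" .
  have "2 \<le> (e - e / 2) * real N" using N(2) e by (simp add: field_simps)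
  then have "\<bar>a * real N - real (boundary_height a N)\<bar> \<le> (e - e / 2) * real N"
    using boundary_height_bounds(1,2)[OF a, of N] by linarith
  with * show ?thesis using descent_deviation_shift by blast
qed simp

lemma pinned_phase:
  assumes a: "0 < a" "a < 1 / 2" and lam: "2 < lam" and F: "a * ln (lam - 1) \<le> Ffree lam" and \<epsilon>: "0 < \<epsilon>"
  shows "(\<lambda>n. piN (2 * n) lam a (\<lambda>\<eta>. \<epsilon> \<le>
      (SUP x\<in>{0..1}. \<bar>interp \<eta> (real (2 * n) * x) / real (2 * n) - fprof a lam x\<bar>))) \<longlonglongrightarrow> 0"
proof -
  define r where "r = 1 / sqrt (lam - 1)"
  note r = pin_parameters[OF lam r_def]
  define e where "e = min (\<epsilon> / 2) 1"
  have e: "0 < e" "e \<le> \<epsilon> / 2" "e \<le> 1" using \<epsilon> by (auto simp: e_def)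
  define c where "c = - (e * ln r)"
  define c' where "c' = (e / 2)\<^sup>2 / 4"
  have "ln r < 0" using r by simp
  then have c: "0 < c" using e by (simp add: c_def mult_pos_neg)
  have c': "0 < c'" using e by (simp add: c'_def)
  define g where "g = ln (lam - 1)"
  have g: "0 \<le> g" using lam by (simp add: g_def)
  have r1: "0 < 1 - r\<^sup>2" using r by (simp add: power_less_one_iff abs_square_less_1)
  let ?P = "\<lambda>n. (2 * real (2 * n) + 3) ^ 4"
  let ?U = "\<lambda>n. (exp (2 * g) * (real (2 * n choose n) / 4 ^ n) + (lam ^ 8 * (?P n * exp (- c * real (2 * n))) +
      (2 * lam ^ 4) * (?P n * exp (- c' * real (2 * n))))) / (1 - r\<^sup>2)"
  show ?thesis
  proof (rule tendsto_sandwich[where f="\<lambda>_. 0" and h="?U"])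
    have "(\<lambda>n. ?U n) \<longlonglongrightarrow> (exp (2 * g) * 0 + (lam ^ 8 * 0 + (2 * lam ^ 4) * 0)) / (1 - r\<^sup>2)"
      using r1 by (intro tendsto_intros central_binomial_ratio_tendsto_0 poly_exp_tendsto_0 c c') auto
    then show "(\<lambda>n. ?U n) \<longlonglongrightarrow> 0" by simp
    show "\<forall>\<^sub>F n in sequentially. 0 \<le> piN (2 * n) lam a (\<lambda>\<eta>. \<epsilon> \<le>
      (SUP x\<in>{0..1}. \<bar>interp \<eta> (real (2 * n) * x) / real (2 * n) - fprof a lam x\<bar>))"
      using lam by (simp add: piN_eq_wsum[OF a(1)] wsum_nonneg weight_nonneg)
    have "\<forall>\<^sub>F n in sequentially. 4 / \<epsilon> < real (2 * n)" "\<forall>\<^sub>F n in sequentially. 4 / e \<le> real (2 * n)"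
      by real_asymp+
    then show "\<forall>\<^sub>F n in sequentially. piN (2 * n) lam a (\<lambda>\<eta>. \<epsilon> \<le>
      (SUP x\<in>{0..1}. \<bar>interp \<eta> (real (2 * n) * x) / real (2 * n) - fprof a lam x\<bar>)) \<le> ?U n"
      using eventually_gt_at_top[of 0]
    proof eventually_elim
      case (elim n)
      define N where "N = 2 * n"
      define A where "A = boundary_height a N"
      define M where "M = (r + 1 / r) ^ N * r ^ (2 * A)"
      let ?Q = "\<lambda>\<eta>. \<epsilon> \<le> (SUP x\<in>{0..1}. \<bar>interp \<eta> (real N * x) / real N - fprof a lam x\<bar>)"
      have A: "A \<le> N + 2" "0 < A" "real A \<le> a * real N + 2"
        using boundary_height_le[OF a, of N] boundary_height_pos[OF a(1), of N] elim
          boundary_height_bounds(2)[OF a(1), of N] by (auto simp: A_def N_def simp del: of_nat_mult)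
      have pow: "(2::real) ^ N = 4 ^ n" by (simp add: N_def power_mult)
      have M_exp: "M = 4 ^ n * exp (real N * Ffree lam - real A * g)"
        unfolding M_def g_def r(5) pow ..
      then have M0: "0 < M" by simp
      have "real A * g \<le> (a * real N + 2) * g" using A g by (intro mult_right_mono) auto
      moreover have "real N * (a * g) \<le> real N * Ffree lam" using F by (intro mult_left_mono) (auto simp: g_def)
      ultimately have "- (2 * g) \<le> real N * Ffree lam - real A * g" by (simp add: algebra_simps)
      then have "4 ^ n * exp (- (2 * g)) \<le> M" unfolding M_exp by simp
      then have "4 ^ n \<le> M * exp (2 * g)" by (simp add: exp_minus field_simps)
      then have "(real (2 * n choose n) / 4 ^ n) * 4 ^ n \<le> (real (2 * n choose n) / 4 ^ n) * (M * exp (2 * g))"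
        by (intro mult_left_mono) auto
      then have B: "real (2 * n choose n) \<le> M * (exp (2 * g) * (real (2 * n choose n) / 4 ^ n))"
        by (simp add: ac_simps)
      have lam0: "0 \<le> lam" using lam by simp
      have cancel: "S / (1 - r\<^sup>2) * (M * (1 - r\<^sup>2)) = M * S" for S using r1 by simp
      have collect: "M * s + (p * (u * M * v) + (p * (w * M * q) + p * (w * M * q)))
          = M * (s + (u * (p * v) + (2 * w) * (p * q)))" for s p u v w q
        by (simp add: algebra_simps)
      have "wsum lam N A A ?Q \<le> wsum lam N A A (\<lambda>\<eta>. ((\<forall>t\<le>N. \<eta> t \<noteq> 0) \<and> True) \<or> (pinned_excursion e N \<eta> \<or>
          (descent_deviation A (dlam lam) (e / 2) N \<eta> \<or> descent_deviation A (dlam lam) (e / 2) N (walk_rev N \<eta>))))"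
        using profile_deviation_cases[OF a(1) lam \<epsilon> e(1,2), of N] elim lam0
        by (intro wsum_mono) (auto simp: A_def N_def)
      also have "\<dots> \<le> wsum lam N A A (\<lambda>\<eta>. (\<forall>t\<le>N. \<eta> t \<noteq> 0) \<and> True) + (wsum lam N A A (pinned_excursion e N)
          + (wsum lam N A A (descent_deviation A (dlam lam) (e / 2) N)
            + wsum lam N A A (\<lambda>\<eta>. descent_deviation A (dlam lam) (e / 2) N (walk_rev N \<eta>))))"
        by (intro order_trans[OF wsum_disj] add_left_mono wsum_disj lam0)
      also have "\<dots> \<le> real (2 * n choose n) + (?P n * (lam ^ 8 * M * exp (- c * real N))
          + (?P n * (lam ^ 4 * M * exp (- c' * real N)) + ?P n * (lam ^ 4 * M * exp (- c' * real N))))"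
      proof (intro add_mono)
        have "wsum lam N A A (\<lambda>\<eta>. (\<forall>t\<le>N. \<eta> t \<noteq> 0) \<and> True) \<le> weight 1 N A A"
          using wsum_nozero_le[of lam N A A "\<lambda>_. True"] by (simp add: wsum_True)
        also have "\<dots> \<le> real (2 * n choose n)" unfolding N_def by (rule free_return_weight_le)
        finally show "wsum lam N A A (\<lambda>\<eta>. (\<forall>t\<le>N. \<eta> t \<noteq> 0) \<and> True) \<le> real (2 * n choose n)" .
        show "wsum lam N A A (pinned_excursion e N) \<le> ?P n * (lam ^ 8 * M * exp (- c * real N))"
          using wsum_pinned_excursion_le[OF r(1,2,3) A(1) e(1)] by (simp add: M_def c_def N_def)
        show *: "wsum lam N A A (descent_deviation A (dlam lam) (e / 2) N) \<le> ?P n * (lam ^ 4 * M * exp (- c' * real N))"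
          using wsum_descent_deviation_le[OF r(1,3) A(1) _ _ r(4), of "e / 2"] e by (simp add: M_def c'_def N_def)
        show "wsum lam N A A (\<lambda>\<eta>. descent_deviation A (dlam lam) (e / 2) N (walk_rev N \<eta>))
            \<le> ?P n * (lam ^ 4 * M * exp (- c' * real N))"
          using * by (simp add: wsum_walk_rev)
      qed
      also have "\<dots> \<le> M * (exp (2 * g) * (real (2 * n choose n) / 4 ^ n)) + (?P n * (lam ^ 8 * M * exp (- c * real N))
          + (?P n * (lam ^ 4 * M * exp (- c' * real N)) + ?P n * (lam ^ 4 * M * exp (- c' * real N))))"
        using B by (rule add_right_mono)
      also have "\<dots> = ?U n * (M * (1 - r\<^sup>2))"
        unfolding N_def cancel by (rule collect)
      also have "\<dots> \<le> ?U n * weight lam N A A"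
      proof (rule mult_left_mono)
        show "M * (1 - r\<^sup>2) \<le> weight lam N A A"
          using pinned_return_weight_ge[OF r(1,2,3) A(2), of n] by (simp add: M_def N_def)
        show "0 \<le> ?U n" using lam r1 by auto
      qed
      finally have "wsum lam N A A ?Q \<le> ?U n * weight lam N A A" .
      moreover have "0 < weight lam N A A"
        using pinned_return_weight_ge[OF r(1,2,3) A(2), of n] mult_pos_pos[OF M0 r1]
        by (simp add: M_def N_def)
      ultimately have "wsum lam N A A ?Q / weight lam N A A \<le> ?U n" by (simp add: pos_divide_le_eq)
      then show ?case unfolding piN_eq_wsum[OF a(1)] by (simp add: A_def N_def)
    qed
  qed simp
qed

lemma unpinned_phase:
  assumes a: "0 < a" "a < 1 / 2" and lam: "0 < lam" "lam \<le> mu" and mu: "2 < mu" "Ffree mu < a * ln (mu - 1)"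
    and \<epsilon>: "0 < \<epsilon>"
  shows "(\<lambda>n. piN (2 * n) lam a (\<lambda>\<eta>. \<epsilon> \<le>
      (SUP x\<in>{0..1}. \<bar>interp \<eta> (real (2 * n) * x) / real (2 * n) - a\<bar>))) \<longlonglongrightarrow> 0"
proof -
  define r where "r = 1 / sqrt (mu - 1)"
  note r = pin_parameters[OF mu(1) r_def]
  define e where "e = min (\<epsilon> / 4) 1"
  have e: "0 < e" "2 * e \<le> \<epsilon> / 2" "e \<le> 1" using \<epsilon> by (auto simp: e_def)
  define c where "c = a * ln (mu - 1) - Ffree mu"
  define c' where "c' = e\<^sup>2 / 4"
  have c: "0 < c" using mu by (simp add: c_def)
  have c': "0 < c'" using e by (simp add: c'_def)
  let ?p = "\<lambda>n. 2 * real (2 * n) + 3"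
  let ?U = "\<lambda>n. mu ^ 4 * (?p n ^ 7 * exp (- c * real (2 * n))) + ?p n ^ 7 * exp (- c' * real (2 * n))"
  show ?thesis
  proof (rule tendsto_sandwich[where f="\<lambda>_. 0" and h="?U"])
    have "(\<lambda>n. ?U n) \<longlonglongrightarrow> mu ^ 4 * 0 + 0"
      by (intro tendsto_intros poly_exp_tendsto_0 c c')
    then show "(\<lambda>n. ?U n) \<longlonglongrightarrow> 0" by simp
    show "\<forall>\<^sub>F n in sequentially. 0 \<le> piN (2 * n) lam a (\<lambda>\<eta>. \<epsilon> \<le>
      (SUP x\<in>{0..1}. \<bar>interp \<eta> (real (2 * n) * x) / real (2 * n) - a\<bar>))"
      using lam by (simp add: piN_eq_wsum[OF a(1)] wsum_nonneg weight_nonneg)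
    have "\<forall>\<^sub>F n in sequentially. 4 / \<epsilon> < real (2 * n)" "\<forall>\<^sub>F n in sequentially. 2 / e \<le> real (2 * n)"
      by real_asymp+
    then show "\<forall>\<^sub>F n in sequentially. piN (2 * n) lam a (\<lambda>\<eta>. \<epsilon> \<le>
      (SUP x\<in>{0..1}. \<bar>interp \<eta> (real (2 * n) * x) / real (2 * n) - a\<bar>)) \<le> ?U n"
      using eventually_gt_at_top[of 0]
    proof eventually_elim
      case (elim n)
      define N where "N = 2 * n"
      define A where "A = boundary_height a N"
      define p where "p = ?p n"
      have p: "1 \<le> p" by (simp add: p_def)
      let ?Q = "\<lambda>\<eta>. \<epsilon> \<le> (SUP x\<in>{0..1}. \<bar>interp \<eta> (real N * x) / real N - a\<bar>)"
      let ?D = "\<lambda>\<eta>. \<exists>x\<le>N. e * real N \<le> \<bar>real (\<eta> x) - real A\<bar>"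
      have A: "A \<le> N + 2" "0 < A" "a * real N \<le> real A" "real A \<le> a * real N + 2"
        using boundary_height_le[OF a, of N] boundary_height_pos[OF a(1), of N] elim
          boundary_height_bounds(1,2)[OF a(1), of N] by (auto simp: A_def N_def simp del: of_nat_mult)
      have pow: "(2::real) ^ N = 4 ^ n" by (simp add: N_def power_mult)
      have "wsum lam N A A ?Q \<le> wsum lam N A A (\<lambda>\<eta>. (\<exists>k\<le>N. \<eta> k = 0) \<or> ((\<forall>t\<le>N. \<eta> t \<noteq> 0) \<and> ?D \<eta>))"
      proof (rule wsum_mono)
        fix \<eta> assume \<eta>: "\<eta> \<in> walks N A A" and "?Q \<eta>"
        then obtain x where x: "x \<le> N" "\<epsilon> / 2 * real N \<le> \<bar>real (\<eta> x) - real N * a\<bar>"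
          using interp_deviation[OF \<eta> \<epsilon>, of "\<lambda>_. a"] elim by (auto simp: N_def)
        have "2 * e * real N \<le> \<epsilon> / 2 * real N" using e by (intro mult_right_mono) auto
        moreover have "2 \<le> e * real N" using elim e by (simp add: N_def field_simps)
        ultimately have "e * real N \<le> \<bar>real (\<eta> x) - real A\<bar>"
          using x(2) A(3,4) unfolding mult.commute[of "real N" a] by linarith
        then have D: "?D \<eta>" using x(1) by (intro exI[of _ x] conjI)
        show "(\<exists>k\<le>N. \<eta> k = 0) \<or> ((\<forall>t\<le>N. \<eta> t \<noteq> 0) \<and> ?D \<eta>)"
        proof (cases "\<exists>k\<le>N. \<eta> k = 0")
          case False
          then have "\<forall>t\<le>N. \<eta> t \<noteq> 0" by simp
          with D show ?thesis by (intro disjI2 conjI)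
        qed (rule disjI1)
      qed (use lam in simp)
      also have "\<dots> \<le> wsum lam N A A (\<lambda>\<eta>. \<exists>k\<le>N. \<eta> k = 0) + wsum lam N A A (\<lambda>\<eta>. (\<forall>t\<le>N. \<eta> t \<noteq> 0) \<and> ?D \<eta>)"
        using lam by (intro wsum_disj) auto
      also have "\<dots> \<le> p ^ 4 * (mu ^ 4 * (4 ^ n * exp (- c * real N))) + p ^ 4 * (4 ^ n * exp (- c' * real N))"
      proof (rule add_mono)
        have "wsum lam N A A (\<lambda>\<eta>. \<exists>k\<le>N. \<eta> k = 0) \<le> wsum mu N A A (\<lambda>\<eta>. \<exists>k\<le>N. \<eta> k = 0)"
          using lam by (intro wsum_mono_param) auto
        also have "\<dots> \<le> (real N + 1) * (mu ^ 4 * (4 ^ n * exp (real N * Ffree mu - real A * ln (mu - 1))))"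
          using wsum_touching_le[OF r(1,3), of N A] unfolding r(5) pow .
        also have "\<dots> \<le> p ^ 4 * (mu ^ 4 * (4 ^ n * exp (- c * real N)))"
        proof (intro mult_mono mult_left_mono)
          have "p \<le> p ^ 4" using p by (simp add: self_le_power)
          then show "real N + 1 \<le> p ^ 4" by (simp add: p_def N_def)
          have "a * real N * ln (mu - 1) \<le> real A * ln (mu - 1)" using A mu by (intro mult_right_mono) auto
          then show "exp (real N * Ffree mu - real A * ln (mu - 1)) \<le> exp (- c * real N)"
            by (simp add: c_def algebra_simps)
        qed (use p mu in auto)
        finally show "wsum lam N A A (\<lambda>\<eta>. \<exists>k\<le>N. \<eta> k = 0) \<le> p ^ 4 * (mu ^ 4 * (4 ^ n * exp (- c * real N)))" .
        show "wsum lam N A A (\<lambda>\<eta>. (\<forall>t\<le>N. \<eta> t \<noteq> 0) \<and> ?D \<eta>) \<le> p ^ 4 * (4 ^ n * exp (- c' * real N))"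
          using order_trans[OF wsum_nozero_le wsum_free_deviation_le[OF A(1) e(1,3)]]
          by (simp add: p_def N_def c'_def power_mult)
      qed
      also have "\<dots> = 4 ^ n * (p ^ 4 * (mu ^ 4 * exp (- c * real N) + exp (- c' * real N)))"
        by (simp add: algebra_simps)
      also have "\<dots> \<le> (weight lam N A A * p ^ 3) * (p ^ 4 * (mu ^ 4 * exp (- c * real N) + exp (- c' * real N)))"
      proof (rule mult_right_mono)
        have "(4::real) ^ n \<le> weight 0 N A A * real (A + n + 1) ^ 3"
          using positive_return_weight_ge[OF A(2), of n] by (simp add: N_def)
        also have "\<dots> \<le> weight lam N A A * p ^ 3"
        proof (rule mult_mono)
          show "weight 0 N A A \<le> weight lam N A A"
            using wsum_mono_param[of 0 lam N A A "\<lambda>_. True"] lam by (simp add: wsum_True)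
          have "A + n + 1 \<le> 2 * N + 3" using A(1) by (simp add: N_def)
          then have "real (A + n + 1) \<le> real (2 * N + 3)" by (rule of_nat_mono)
          then show "real (A + n + 1) ^ 3 \<le> p ^ 3" by (intro power_mono) (auto simp: p_def N_def)
        qed (use lam in \<open>auto simp: weight_nonneg\<close>)
        finally show "4 ^ n \<le> weight lam N A A * p ^ 3" .
      qed (use p mu in auto)
      also have "\<dots> = ?U n * weight lam N A A"
      proof -
        have p7: "p ^ 7 = p ^ 3 * p ^ 4" by (simp add: power_add[symmetric])
        have "2 * real N + 3 = p" by (simp add: p_def N_def)
        then show ?thesis
          unfolding N_def[symmetric] by (simp only: p7) (simp only: algebra_simps)
      qed
      finally have "wsum lam N A A ?Q \<le> ?U n * weight lam N A A" .
      moreover have "0 < weight lam N A A"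
      proof -
        have "0 < (4::real) ^ n" by simp
        also have "(4::real) ^ n \<le> weight 0 N A A * real (A + n + 1) ^ 3"
          using positive_return_weight_ge[OF A(2), of n] by (simp add: N_def)
        finally have "0 < weight 0 N A A" by (simp add: zero_less_mult_iff)
        then show ?thesis
          using wsum_mono_param[of 0 lam N A A "\<lambda>_. True"] lam by (simp add: wsum_True)
      qed
      ultimately have "wsum lam N A A ?Q / weight lam N A A \<le> ?U n" by (simp add: pos_divide_le_eq)
      then show ?case unfolding piN_eq_wsum[OF a(1)] by (simp add: A_def N_def)
    qed
  qed simp
qed

theorem theorem2p2:
  fixes a lam :: real
  assumes "0 < a" and "a < 1/2" and "lam > 0"
  shows "(lam \<ge> lambda_c a \<longrightarrow> (\<forall>\<epsilon>>0.
            (\<lambda>n. piN (2*n) lam a (\<lambda>\<eta>.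
               (SUP x\<in>{0..1}. \<bar>interp \<eta> (real (2*n) * x) / real (2*n) - fprof a lam x\<bar>) \<ge> \<epsilon>))
            \<longlonglongrightarrow> 0))
       \<and> (lam < lambda_c a \<longrightarrow> (\<forall>\<epsilon>>0.
            (\<lambda>n. piN (2*n) lam a (\<lambda>\<eta>.
               (SUP x\<in>{0..1}. \<bar>interp \<eta> (real (2*n) * x) / real (2*n) - a\<bar>) \<ge> \<epsilon>))
            \<longlonglongrightarrow> 0))"
proof (intro conjI impI allI)
  fix \<epsilon> :: real assume \<epsilon>: "0 < \<epsilon>" and lam: "lambda_c a \<le> lam"
  show "(\<lambda>n. piN (2*n) lam a (\<lambda>\<eta>.
      (SUP x\<in>{0..1}. \<bar>interp \<eta> (real (2*n) * x) / real (2*n) - fprof a lam x\<bar>) \<ge> \<epsilon>)) \<longlonglongrightarrow> 0"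
    using lambda_c_properties[OF assms(1,2)] lam by (intro pinned_phase assms \<epsilon>) auto
next
  fix \<epsilon> :: real assume \<epsilon>: "0 < \<epsilon>" and lam: "lam < lambda_c a"
  obtain mu where mu: "max 2 lam < mu" "mu < lambda_c a"
    using dense[of "max 2 lam" "lambda_c a"] lambda_c_properties(1)[OF assms(1,2)] lam by auto
  show "(\<lambda>n. piN (2*n) lam a (\<lambda>\<eta>.
      (SUP x\<in>{0..1}. \<bar>interp \<eta> (real (2*n) * x) / real (2*n) - a\<bar>) \<ge> \<epsilon>)) \<longlonglongrightarrow> 0"
    using lambda_c_properties(2)[OF assms(1,2)] mu
    by (intro unpinned_phase[where mu=mu] assms \<epsilon>) auto
qed

end
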